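(* Let $Y=\{Y_t,t\in T\}$ be a stationary centered Gaussian real-valued random field with $\mathrm{Var}\,Y_t=1$ and covariance function $C_Y(t)=\mathrm{Cov}(Y_0,Y_t)$, $t\in T$. Assume that $|C_Y(t)|<1$ for all $t\ne 0$ if $T$ is countable, and for $\nu_d$-almost every $t\in T$ if $T$ is uncountable. Let $X_t=G(Y_t)$, $t\in T$, where $G:\mathbb{R}\to\mathbb{R}$ is a right-continuous strictly monotone (increasing or decreasing) function with image $\mathrm{Im}(G)$. For a finite measure $\mu$ on $\mathbb{R}$ and $k\in\mathbb{N}_0$ let $$b_k(\mu)=\Big(\int_{\mathrm{Im}(G)}H_k(G^-(u))\,\varphi(G^-(u))\,\mu(du)\Big)^2 .$$ Then $X$ is short range dependent if and only if $$\sum_{k=1}^\infty\frac{b_{k-1}(\mu)}{k!}\int_T|C_Y(t)|\,C_Y^{k-1}(t)\,dt<+\infty$$ for every finite measure $\mu$ on $\mathbb{R}$.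
   Context: $T$ is an unbounded subset of $\mathbb{R}^d$, $d\ge1$ (with $0\in T$); $\nu_d$ is $d$-dimensional Lebesgue measure; $\mathbb{N}_0=\mathbb{N}\cup\{0\}$. For discrete index sets (say $T\subseteq\mathbb{Z}^d$), $\int_T\,dt$ is to be replaced by $\sum_{t\in T,\,t\neq0}$. $\varphi$ is the standard normal density and $H_n(x)=(-1)^n\varphi^{(n)}(x)/\varphi(x)$, $n\in\mathbb{N}_0$, are the Hermite polynomials. Generalized inverse: if $G$ is increasing, $G^-(u)=\inf\{x:G(x)\ge u\}$; if $G$ is decreasing, $G^-(u)$ is the generalized inverse of the increasing function $-G$ evaluated at $-u$, i.e. $G^-(u)=\inf\{x: G(x)\le u\}$. For $t\in T$, $u,v\in\mathbb{R}$ put $\mathrm{Cov}_X(t,u,v)=\mathrm{Cov}(\mathbf 1(X_0>u),\mathbf 1(X_t>v))$. Definition. A stationary real-valued random field $X=\{X_t,t\in T\}$ is called short range dependent (s.r.d.) if for every finite measure $\mu$ on $\mathbb{R}$ $$\sigma^2_{\mu,X}:=\int_T\int_{\mathbb{R}^2}|\mathrm{Cov}_X(t,u,v)|\,\mu(du)\,\mu(dv)\,dt<+\infty .$$ *)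

theory Defs
  imports "HOL-Probability.Probability"
begin

text \<open>Random fields indexed by a set \<open>T\<close> are functions \<open>X :: 'i \<Rightarrow> 'w \<Rightarrow> real\<close> on a
  probability space \<open>M\<close>; values \<open>X t\<close> with \<open>t \<notin> T\<close> are irrelevant.\<close>

definition random_field :: "'w measure \<Rightarrow> 'i set \<Rightarrow> ('i \<Rightarrow> 'w \<Rightarrow> real) \<Rightarrow> bool" where
  "random_field M T X \<longleftrightarrow> (\<forall>t\<in>T. X t \<in> borel_measurable M)"

text \<open>Strict stationarity on an arbitrary index set: the finite-dimensional distributions are
  invariant under every translation that keeps the points in \<open>T\<close>.\<close>

definition stationary_field ::
    "'w measure \<Rightarrow> 'i::ab_group_add set \<Rightarrow> ('i \<Rightarrow> 'w \<Rightarrow> real) \<Rightarrow> bool" where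
  "stationary_field M T X \<longleftrightarrow> random_field M T X \<and>
     (\<forall>I h. finite I \<longrightarrow> I \<subseteq> T \<longrightarrow> (\<forall>t\<in>I. t + h \<in> T) \<longrightarrow>
        distr M (\<Pi>\<^sub>M t\<in>I. borel) (\<lambda>\<omega>. \<lambda>t\<in>I. X (t + h) \<omega>) =
        distr M (\<Pi>\<^sub>M t\<in>I. borel) (\<lambda>\<omega>. \<lambda>t\<in>I. X t \<omega>))"

text \<open>Point masses count as (degenerate) Gaussian distributions.\<close>

definition gaussian_rv :: "'w measure \<Rightarrow> ('w \<Rightarrow> real) \<Rightarrow> bool" where
  "gaussian_rv M Z \<longleftrightarrow> Z \<in> borel_measurable M \<and>
     ((\<exists>m \<sigma>. \<sigma> > 0 \<and> distributed M lborel Z (normal_density m \<sigma>)) \<or>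
      (\<exists>m. AE \<omega> in M. Z \<omega> = m))"

definition gaussian_field :: "'w measure \<Rightarrow> 'i set \<Rightarrow> ('i \<Rightarrow> 'w \<Rightarrow> real) \<Rightarrow> bool" where
  "gaussian_field M T X \<longleftrightarrow> random_field M T X \<and>
     (\<forall>I a. finite I \<longrightarrow> I \<subseteq> T \<longrightarrow> gaussian_rv M (\<lambda>\<omega>. \<Sum>t\<in>I. a t * X t \<omega>))"

definition covariance :: "'w measure \<Rightarrow> ('w \<Rightarrow> real) \<Rightarrow> ('w \<Rightarrow> real) \<Rightarrow> real" where
  "covariance M Z W =
     (\<integral>\<omega>. (Z \<omega> - (\<integral>\<omega>'. Z \<omega>' \<partial>M)) * (W \<omega> - (\<integral>\<omega>'. W \<omega>' \<partial>M)) \<partial>M)"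

text \<open>The measure behind \<open>\<integral>\<^sub>T dt\<close>: for countable \<open>T\<close> the integral is the sum over
  \<open>t \<in> T\<close>, \<open>t \<noteq> 0\<close>, otherwise it is the Lebesgue integral over \<open>T\<close>.\<close>

definition index_measure :: "'i::euclidean_space set \<Rightarrow> 'i measure" where
  "index_measure T = (if countable T then count_space (T - {0}) else lebesgue_on T)"

definition exceedance_cov ::
    "'w measure \<Rightarrow> ('i::zero \<Rightarrow> 'w \<Rightarrow> real) \<Rightarrow> 'i \<Rightarrow> real \<Rightarrow> real \<Rightarrow> real" where
  "exceedance_cov M X t u v =
     covariance M (\<lambda>\<omega>. indicator {u<..} (X 0 \<omega>)) (\<lambda>\<omega>. indicator {v<..} (X t \<omega>))"

definition finite_real_measure :: "real measure \<Rightarrow> bool" where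
  "finite_real_measure \<mu> \<longleftrightarrow> finite_measure \<mu> \<and> sets \<mu> = sets borel"

definition srd_variance ::
    "'w measure \<Rightarrow> 'i::euclidean_space set \<Rightarrow> ('i \<Rightarrow> 'w \<Rightarrow> real) \<Rightarrow> real measure \<Rightarrow> ennreal" where
  "srd_variance M T X \<mu> =
     (\<integral>\<^sup>+ t. (\<integral>\<^sup>+ p. ennreal \<bar>exceedance_cov M X t (fst p) (snd p)\<bar> \<partial>(\<mu> \<Otimes>\<^sub>M \<mu>)) \<partial>index_measure T)"

definition short_range_dependent ::
    "'w measure \<Rightarrow> 'i::euclidean_space set \<Rightarrow> ('i \<Rightarrow> 'w \<Rightarrow> real) \<Rightarrow> bool" where
  "short_range_dependent M T X \<longleftrightarrow> stationary_field M T X \<and>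
     (\<forall>\<mu>. finite_real_measure \<mu> \<longrightarrow> srd_variance M T X \<mu> < \<infinity>)"

definition hermite :: "nat \<Rightarrow> real \<Rightarrow> real" where
  "hermite n x = (-1) ^ n * (deriv ^^ n) std_normal_density x / std_normal_density x"

text \<open>For strictly monotone \<open>G\<close> both sets below are nonempty and bounded below whenever
  \<open>u \<in> range G\<close>; the value elsewhere depends on the conventions for \<open>Inf\<close> and is not used.\<close>

definition gen_inverse :: "(real \<Rightarrow> real) \<Rightarrow> real \<Rightarrow> real" where
  "gen_inverse G u = (if mono G then Inf {x. G x \<ge> u} else Inf {x. G x \<le> u})"

definition hermite_coeff :: "(real \<Rightarrow> real) \<Rightarrow> real measure \<Rightarrow> nat \<Rightarrow> real" where
  "hermite_coeff G \<mu> k =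
     (\<integral>u\<in>range G. hermite k (gen_inverse G u) * std_normal_density (gen_inverse G u) \<partial>\<mu>)\<^sup>2"

text \<open>Finiteness of \<open>\<Sum>k\<ge>1. b k * (\<integral>f k dN)\<close> for real \<open>b k\<close> and functions \<open>f k\<close> of
  arbitrary sign: all terms are finite (with \<open>0 \<sqdot> \<infinity> = 0\<close>, so nothing is required of
  \<open>f k\<close> when \<open>b k = 0\<close>) and the series of reals converges. The integrability clause is needed
  because the Bochner integral of a non-integrable function is 0.\<close>

definition integral_series_finite ::
    "'i measure \<Rightarrow> (nat \<Rightarrow> real) \<Rightarrow> (nat \<Rightarrow> 'i \<Rightarrow> real) \<Rightarrow> bool" where
  "integral_series_finite N b f \<longleftrightarrow>
     (\<forall>k\<ge>1. b k \<noteq> 0 \<longrightarrow> integrable N (f k)) \<and>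
     summable (\<lambda>j. b (Suc j) * (\<integral>t. f (Suc j) t \<partial>N))"

end

theory Submission
  imports Defs
begin

text \<open>Both sides of the equivalence say the same thing: that \<open>C\<close> is integrable over the index set.

The exceedance covariances are comparable to \<open>C t\<close>. If \<open>U, V\<close> are standard Gaussian with
correlation \<open>r\<close>, \<open>\<bar>r\<bar> < 1\<close>, then \<open>V = r U + s W\<close> with \<open>s\<^sup>2 = 1 - r\<^sup>2\<close> and a standard
Gaussian \<open>W\<close> independent of \<open>U\<close>. Replacing \<open>V\<close> by \<open>s W\<close> makes every covariance vanish, and it
moves the argument only by \<open>r U\<close>, so it changes the indicator of a half line with probability at
most a multiple of \<open>\<bar>r\<bar>\<close>, as long as \<open>\<bar>r\<bar>\<close> stays away from \<open>1\<close>; for the other \<open>r\<close> such a bound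
is trivial. Hence \<open>\<bar>Cov (G U > u, G V > v)\<bar> \<le> 4 \<bar>r\<bar>\<close> for all levels
(\<open>abs_covariance_exceedance_le\<close>). At the level \<open>u = v = G 0\<close>, for increasing \<open>G\<close>, the change on \<open>U > 0\<close>
always has the sign of \<open>r\<close>, and on an event of probability of order \<open>\<bar>r\<bar>\<close> it really happens (for decreasing
\<open>G\<close> pass to \<open>- U, - V\<close>), so
\<open>\<bar>r\<bar>\<close> is also a lower bound up to a constant (\<open>abs_covariance_exceedance_ge\<close>). Integrating
the upper bound shows that \<open>\<sigma>\<^sup>2\<close> is finite for every \<open>\<mu>\<close> when \<open>C\<close> is integrable; the lower bound
with \<open>\<mu>\<close> the unit mass at \<open>G 0\<close> shows the converse.

On the side of the series, the same \<open>\<mu>\<close> has \<open>b 0 > 0\<close>, and the term \<open>k = 1\<close> alone forces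
\<open>C\<close> to be integrable (\<open>hermite_coeff_return_0_pos\<close>). Conversely
\<open>\<bar>\<integral> \<bar>C\<bar> C ^ (k - 1)\<bar> \<le> \<integral> \<bar>C\<bar>\<close>, so the series converges absolutely as soon as
\<open>\<Sum> b (k - 1) / k!\<close> does. As \<open>H k \<phi>\<close> is up to sign the \<open>k\<close>-th derivative of the Gaussian density
\<open>\<phi>\<close>, this follows from a bound for its supremum (\<open>summable_gauss_deriv_bound\<close>). The bound
has to be sharp up to a constant: the terms are of order \<open>k powr (- 3 / 2)\<close> at worst, and a
bound that holds uniformly at the scale \<open>\<bar>H k \<phi>\<bar>\<^sup>2 \<le> c * k!\<close> would only give \<open>1 / k\<close>.\<close>

section \<open>Derivatives of the Gaussian density\<close>

text \<open>The derivatives of \<open>\<phi>\<close>: differentiating \<open>\<phi>' = - x \<phi>\<close> repeatedly gives this recurrence,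
which also provides the differential equation for the bound below.\<close>

fun gauss_deriv :: "nat \<Rightarrow> real \<Rightarrow> real" where
  "gauss_deriv 0 x = std_normal_density x"
| "gauss_deriv (Suc 0) x = - x * std_normal_density x"
| "gauss_deriv (Suc (Suc n)) x = - x * gauss_deriv (Suc n) x - real (Suc n) * gauss_deriv n x"

lemma has_real_derivative_std_normal_density:
  "(std_normal_density has_real_derivative - x * std_normal_density x) (at x)"
  unfolding std_normal_density_def
  by (auto intro!: derivative_eq_intros simp: field_simps)

lemma has_real_derivative_gauss_deriv:
  "(gauss_deriv n has_real_derivative gauss_deriv (Suc n) x) (at x)"
proof (induction n x rule: gauss_deriv.induct)
  case (1 x)
  then show ?case using has_real_derivative_std_normal_density[of x] by simp
next
  case (2 x)
  have "((\<lambda>x. - x * std_normal_density x) has_real_derivative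
      (- 1) * std_normal_density x + (- x * std_normal_density x) * (- x)) (at x)"
    by (intro DERIV_mult has_real_derivative_std_normal_density)
       (auto intro!: derivative_eq_intros)
  then show ?case by (simp add: algebra_simps)
next
  case (3 n x)
  have "((\<lambda>x. - x * gauss_deriv (Suc n) x - real (Suc n) * gauss_deriv n x) has_real_derivative
      ((- 1) * gauss_deriv (Suc n) x + gauss_deriv (Suc (Suc n)) x * (- x))
        - real (Suc n) * gauss_deriv (Suc n) x) (at x)"
    by (intro DERIV_diff DERIV_mult DERIV_cmult 3) (auto intro!: derivative_eq_intros)
  then show ?case by (simp add: algebra_simps)
qed

lemma hermite_times_density:
  "hermite n x * std_normal_density x = (-1) ^ n * gauss_deriv n x"
proof -
  have "(deriv ^^ n) std_normal_density = gauss_deriv n"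
  proof (induction n)
    case (Suc n)
    then show ?case
      using DERIV_imp_deriv[OF has_real_derivative_gauss_deriv] by auto
  qed auto
  moreover have "std_normal_density x \<noteq> 0"
    using normal_density_pos[of 1 0 x] by simp
  ultimately show ?thesis by (simp add: hermite_def)
qed

text \<open>The value at \<open>0\<close> of the energy \<open>g'\<^sup>2 + (n + 1) g\<^sup>2\<close> of the \<open>n\<close>-th derivative \<open>g\<close>, divided by \<open>n + 1\<close>.\<close>

definition gauss_deriv_bound :: "nat \<Rightarrow> real" where
  "gauss_deriv_bound n = (gauss_deriv n 0)\<^sup>2 + (gauss_deriv (Suc n) 0)\<^sup>2 / real (Suc n)"

text \<open>An energy argument: \<open>g = \<phi>\<^sup>(\<^sup>n\<^sup>)\<close> solves \<open>g'' + x g' + (n + 1) g = 0\<close>, so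
\<open>g'\<^sup>2 + (n + 1) g\<^sup>2\<close> has derivative \<open>- 2 x g'\<^sup>2\<close> and is largest at \<open>0\<close>.\<close>

lemma gauss_deriv_sq_le: "(gauss_deriv n x)\<^sup>2 \<le> gauss_deriv_bound n"
proof -
  define E where "E y = (gauss_deriv (Suc n) y)\<^sup>2 + real (Suc n) * (gauss_deriv n y)\<^sup>2" for y
  have E': "(E has_real_derivative - 2 * y * (gauss_deriv (Suc n) y)\<^sup>2) (at y)" for y
  proof -
    have "(E has_real_derivative
        2 * gauss_deriv (Suc n) y * gauss_deriv (Suc (Suc n)) y
        + real (Suc n) * (2 * gauss_deriv n y * gauss_deriv (Suc n) y)) (at y)"
      unfolding E_def
      by (rule derivative_eq_intros has_real_derivative_gauss_deriv refl | simp)+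
    then show ?thesis by (simp add: algebra_simps power2_eq_square)
  qed
  have "E x \<le> E 0"
  proof (cases "x \<ge> 0")
    case True
    show ?thesis
      by (rule DERIV_nonpos_imp_nonincreasing[OF True])
         (use E' in \<open>fastforce simp: mult_nonneg_nonpos mult_nonpos_nonneg\<close>)
  next
    case False
    show ?thesis
      by (rule DERIV_nonneg_imp_nondecreasing[of x 0])
         (use E' False in \<open>force simp: mult_nonpos_nonneg\<close>)+
  qed
  moreover have "real (Suc n) * (gauss_deriv n x)\<^sup>2 \<le> E x" by (simp add: E_def)
  ultimately have "real (Suc n) * (gauss_deriv n x)\<^sup>2 \<le> E 0" by simp
  then show ?thesis
    by (simp add: E_def gauss_deriv_bound_def field_simps)
qed

lemma gauss_deriv_bound_nonneg: "0 \<le> gauss_deriv_bound n"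
  using gauss_deriv_sq_le[of n 0] by (meson order_trans zero_le_power2)

lemma gauss_deriv_bound_step:
  "gauss_deriv_bound (Suc (Suc n))
     \<le> (real n + 1) * (real n + 2)\<^sup>2 / (real n + 3) * gauss_deriv_bound n"
proof -
  define p q where "p = (gauss_deriv n 0)\<^sup>2" and "q = (gauss_deriv (Suc n) 0)\<^sup>2"
  have pq: "p \<ge> 0" "q \<ge> 0" by (auto simp: p_def q_def)
  have "gauss_deriv_bound (Suc (Suc n))
      = (real n + 1)\<^sup>2 * p + (real n + 2)\<^sup>2 * q / (real n + 3)"
    by (simp add: gauss_deriv_bound_def p_def q_def power2_eq_square algebra_simps)
  also have "(real n + 1)\<^sup>2 * p \<le> (real n + 1) * (real n + 2)\<^sup>2 / (real n + 3) * p"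
    by (intro mult_right_mono pq) (simp add: field_simps power2_eq_square)
  also have "(real n + 2)\<^sup>2 * q / (real n + 3)
      = (real n + 1) * (real n + 2)\<^sup>2 / (real n + 3) * (q / (real n + 1))"
    by simp
  also have "(real n + 1) * (real n + 2)\<^sup>2 / (real n + 3) * p + \<dots>
     = (real n + 1) * (real n + 2)\<^sup>2 / (real n + 3) * gauss_deriv_bound n"
    by (simp only: gauss_deriv_bound_def p_def q_def distrib_left of_nat_Suc add.commute[of 1])
  finally show ?thesis by simp
qed

text \<open>The terms are of order \<open>n powr (- 3 / 2)\<close>, which the ratio test does not see; instead
\<open>a n \<le> c n - c (n + 2)\<close> with \<open>c n = (n + 2) a n\<close>, and the sum telescopes.\<close>

lemma summable_gauss_deriv_bound: "summable (\<lambda>n. gauss_deriv_bound n / fact (Suc n))"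
proof -
  define a where "a n = gauss_deriv_bound n / fact (Suc n)" for n
  define c where "c n = (real n + 2) * a n" for n
  have a_nonneg: "a n \<ge> 0" for n
    by (simp add: a_def gauss_deriv_bound_nonneg)
  then have c_nonneg: "c n \<ge> 0" for n by (simp add: c_def)
  have a_step: "a (Suc (Suc n)) \<le> (real n + 1) * (real n + 2) / (real n + 3)\<^sup>2 * a n" for n
  proof -
    have f: "fact (Suc (Suc (Suc n))) = (real n + 3) * (real n + 2) * fact (Suc n)"
      by (simp add: algebra_simps)
    have "a (Suc (Suc n)) \<le> ((real n + 1) * (real n + 2)\<^sup>2 / (real n + 3) * gauss_deriv_bound n)
        / ((real n + 3) * (real n + 2) * fact (Suc n))"
      unfolding a_def f by (intro divide_right_mono gauss_deriv_bound_step) auto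
    also have "\<dots> = (real n + 1) * (real n + 2) / (real n + 3)\<^sup>2 * a n"
      by (simp add: a_def power2_eq_square divide_simps del: fact_Suc)
    finally show ?thesis .
  qed
  have tele: "a n \<le> c n - c (Suc (Suc n))" for n
  proof -
    have "c (Suc (Suc n)) \<le> (real n + 4) * ((real n + 1) * (real n + 2) / (real n + 3)\<^sup>2 * a n)"
      unfolding c_def using a_step[of n] by (intro mult_mono) (auto simp: a_nonneg)
    also have "\<dots> = ((real n + 4) * ((real n + 1) * (real n + 2)) / (real n + 3)\<^sup>2) * a n"
      by simp
    also have "\<dots> \<le> (real n + 1) * a n"
      by (intro mult_right_mono a_nonneg, subst pos_divide_le_eq, simp,
          simp add: algebra_simps power2_eq_square)
    also have "\<dots> = c n - a n" by (simp add: c_def algebra_simps)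
    finally show ?thesis by simp
  qed
  have "sum a {..<n} \<le> c 0 + c 1 - c n - c (Suc n)" for n
  proof (induction n)
    case (Suc n)
    then show ?case using tele[of n] by simp
  qed simp
  then have "sum a {..<n} \<le> c 0 + c 1" for n
    using c_nonneg[of n] c_nonneg[of "Suc n"] by (smt (verit))
  then have "summable a"
    by (intro summableI_nonneg_bounded a_nonneg)
  then show ?thesis by (simp add: a_def[abs_def])
qed

section \<open>Independence from characteristic functions\<close>

text \<open>Levy's uniqueness theorem for the finite measures with densities \<open>g\<close> and \<open>h\<close>, transported
to the line by \<open>W\<close>. The case \<open>b = 0\<close> of the hypothesis gives both the same mass, so both can be
normalized to probability laws.\<close>

lemma (in prob_space) weighted_law_eq_if_char_eq:
  fixes W g h :: "'a \<Rightarrow> real"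
  assumes [measurable]: "W \<in> borel_measurable M"
    and g: "integrable M g" "\<And>x. g x \<ge> 0" and h: "integrable M h" "\<And>x. h x \<ge> 0"
    and eq: "\<And>b. (CLINT x|M. of_real (g x) * iexp (b * W x)) = (CLINT x|M. of_real (h x) * iexp (b * W x))"
    and B: "B \<in> sets borel"
  shows "(\<integral>x. g x * indicator B (W x) \<partial>M) = (\<integral>x. h x * indicator B (W x) \<partial>M)"
proof -
  have [measurable]: "g \<in> borel_measurable M" "h \<in> borel_measurable M" "B \<in> sets borel"
    using g h B by auto
  have "(\<integral>x. complex_of_real (g x) \<partial>M) = (\<integral>x. complex_of_real (h x) \<partial>M)"
    using eq[of 0] by simp
  then have same: "expectation g = expectation h" by simp
  define c where "c = expectation g"
  have "c \<ge> 0" unfolding c_def by (intro integral_nonneg_AE) (auto simp: g)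
  show ?thesis
  proof (cases "c = 0")
    case True
    have "AE x in M. g x = 0" "AE x in M. h x = 0"
      using integral_nonneg_eq_0_iff_AE[OF g(1)] integral_nonneg_eq_0_iff_AE[OF h(1)]
        True same g(2) h(2) by (auto simp: c_def)
    then have "(\<integral>x. g x * indicator B (W x) \<partial>M) = 0"
      "(\<integral>x. h x * indicator B (W x) \<partial>M) = 0"
      by (auto simp: eventually_mono intro!: integral_eq_zero_AE)
    then show ?thesis by simp
  next
    case False
    with \<open>c \<ge> 0\<close> have c: "c > 0" by simp
    define law where "law k = distr (density M (\<lambda>x. ennreal (k x / c))) borel W"
      for k :: "'a \<Rightarrow> real"
    have law: "real_distribution (law k)"
      "char (law k) b = (CLINT x|M. of_real (k x) * iexp (b * W x)) / c"
      "(\<integral>x. k x * indicator B (W x) \<partial>M) = c * measure (law k) B"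
      if k[measurable]: "k \<in> borel_measurable M" and int: "integrable M k" and pos: "\<And>x. k x \<ge> 0"
        and exp: "expectation k = c" for k b
    proof -
      have "(\<integral>\<^sup>+x. ennreal (k x / c) \<partial>M) = ennreal (\<integral>x. k x / c \<partial>M)"
        using c pos int by (intro nn_integral_eq_integral) auto
      also have "\<dots> = 1" using c exp by simp
      finally have "(\<integral>\<^sup>+x. ennreal (k x / c) \<partial>M) = 1" .
      then have "prob_space (density M (\<lambda>x. ennreal (k x / c)))"
        by (intro prob_spaceI) (simp add: emeasure_density cong: nn_integral_cong)
      then interpret D: prob_space "density M (\<lambda>x. ennreal (k x / c))" .
      interpret L: real_distribution "law k"
        unfolding law_def by (rule D.real_distribution_distr) simp
      show "real_distribution (law k)" by unfold_locales
      have "char (law k) b = (\<integral>x. (k x / c) *\<^sub>R iexp (b * W x) \<partial>M)"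
        unfolding char_def law_def using c pos
        by (simp add: integral_distr integral_density)
      also have "\<dots> = (\<integral>x. of_real (k x) * iexp (b * W x) / of_real c \<partial>M)"
        by (intro Bochner_Integration.integral_cong) (auto simp: scaleR_conv_of_real)
      finally show "char (law k) b = (CLINT x|M. of_real (k x) * iexp (b * W x)) / c"
        by simp
      have "measure (law k) B = (\<integral>x. indicator B x \<partial>law k)"
        by (simp add: law_def)
      also have "\<dots> = (\<integral>x. (k x / c) *\<^sub>R indicator B (W x) \<partial>M)"
        unfolding law_def using c pos
        by (subst integral_distr, simp, simp, subst integral_density) simp_all
      also have "\<dots> = (\<integral>x. k x * indicator B (W x) \<partial>M) / c"
        by simp
      finally show "(\<integral>x. k x * indicator B (W x) \<partial>M) = c * measure (law k) B"
        using c by simp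
    qed
    have "law g = law h"
    proof (rule Levy_uniqueness)
      show "real_distribution (law g)" "real_distribution (law h)"
        using g h same by (auto intro!: law simp: c_def)
      show "char (law g) = char (law h)"
        using g h same eq by (auto simp: fun_eq_iff law(2) c_def)
    qed
    then show ?thesis
      using law(3)[of g] law(3)[of h] g h same by (simp add: c_def)
  qed
qed

text \<open>The plane is reduced to uniqueness on the line, applied twice. First \<open>U\<close> enters through the
positive weight \<open>2 + cos (a U + \<theta>)\<close>, whose law along \<open>W\<close> is identified; this gives
\<open>E (exp (\<i> a U); W \<in> B) = E (exp (\<i> a U)) P (W \<in> B)\<close>. Then the indicator of \<open>W \<in> B\<close> is the
weight, and the law along \<open>U\<close> is identified.\<close>

lemma (in prob_space) indep_var_if_char_factorizes:
  fixes U W :: "'a \<Rightarrow> real"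
  assumes [measurable]: "U \<in> borel_measurable M" "W \<in> borel_measurable M"
    and factor: "\<And>a b. (CLINT x|M. iexp (a * U x + b * W x))
      = (CLINT x|M. iexp (a * U x)) * (CLINT x|M. iexp (b * W x))"
  shows "indep_var borel U borel W"
proof -
  have int: "integrable M f" if "f \<in> borel_measurable M" "\<And>x. norm (f x) \<le> K"
    for f :: "'a \<Rightarrow> 'b::{banach,second_countable_topology}" and K
    using that by (intro integrable_const_bound[of _ K]) auto
  have prod: "(CLINT x|M. iexp (a * U x) * iexp (b * W x))
      = (CLINT x|M. iexp (a * U x)) * (CLINT x|M. iexp (b * W x))" for a b
    using factor[of a b] by (simp add: exp_add[symmetric] distrib_left)
  have cos_eq: "complex_of_real (cos (a + \<theta>)) = (iexp \<theta> / 2) * iexp a + (iexp (- \<theta>) / 2) * iexp (- a)"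
    for a \<theta>
  proof -
    have "complex_of_real (cos (a + \<theta>)) = (iexp (a + \<theta>) + iexp (- (a + \<theta>))) / 2"
      by (simp only: cos_of_real[symmetric] cos_exp_eq of_real_minus mult_minus_right mult_minus_left)
    also have "iexp (a + \<theta>) = iexp \<theta> * iexp a"
      by (simp add: exp_add[symmetric] algebra_simps)
    also have "iexp (- (a + \<theta>)) = iexp (- \<theta>) * iexp (- a)"
      by (simp only: minus_add_distrib add.commute[of "- a"] of_real_add distrib_left exp_add)
    finally show ?thesis by (simp add: add_divide_distrib)
  qed
  \<comment> \<open>The phase \<open>\<theta>\<close> covers the real and the imaginary part of \<open>iexp (a * U x)\<close> at once; the constant
    \<open>2\<close> keeps the weight positive.\<close>
  have step1: "expectation (\<lambda>x. cos (a * U x + \<theta>) * indicator B (W x))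
      = expectation (\<lambda>x. cos (a * U x + \<theta>)) * expectation (\<lambda>x. indicator B (W x))"
    if [measurable]: "B \<in> sets borel" for a \<theta> B
  proof -
    define k where "k x = cos (a * U x + \<theta>)" for x
    have [measurable]: "k \<in> borel_measurable M" unfolding k_def by measurable
    have k: "\<bar>k x\<bar> \<le> 1" for x by (simp add: k_def)
    have ik: "integrable M k" by (rule int[of _ 1]) (auto simp: k)
    have kW: "(CLINT x|M. of_real (k x) * iexp (b * W x))
        = of_real (expectation k) * (CLINT x|M. iexp (b * W x))" for b
    proof -
      have "(CLINT x|M. of_real (k x) * iexp (b * W x))
          = (CLINT x|M. (iexp \<theta> / 2) * (iexp (a * U x) * iexp (b * W x))
              + (iexp (- \<theta>) / 2) * (iexp ((- a) * U x) * iexp (b * W x)))"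
        unfolding k_def cos_eq by (simp add: algebra_simps)
      also have "\<dots> = (iexp \<theta> / 2) * (CLINT x|M. iexp (a * U x) * iexp (b * W x))
              + (iexp (- \<theta>) / 2) * (CLINT x|M. iexp ((- a) * U x) * iexp (b * W x))"
        by (subst Bochner_Integration.integral_add)
           (auto intro!: int[of _ 1] integrable_mult_right simp: norm_mult simp del: of_real_mult of_real_minus)
      also have "\<dots> = ((iexp \<theta> / 2) * (CLINT x|M. iexp (a * U x))
              + (iexp (- \<theta>) / 2) * (CLINT x|M. iexp ((- a) * U x))) * (CLINT x|M. iexp (b * W x))"
        unfolding prod by (simp add: algebra_simps)
      also have "(iexp \<theta> / 2) * (CLINT x|M. iexp (a * U x))
              + (iexp (- \<theta>) / 2) * (CLINT x|M. iexp ((- a) * U x))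
          = (CLINT x|M. (iexp \<theta> / 2) * iexp (a * U x) + (iexp (- \<theta>) / 2) * iexp ((- a) * U x))"
        by (subst Bochner_Integration.integral_add)
           (auto intro!: int[of _ 1] integrable_mult_right simp: norm_mult simp del: of_real_mult of_real_minus)
      also have "\<dots> = (CLINT x|M. of_real (k x))"
        unfolding k_def cos_eq by simp
      also have "\<dots> = of_real (expectation k)" by simp
      finally show ?thesis .
    qed
    have "(\<integral>x. (2 + k x) * indicator B (W x) \<partial>M) = (\<integral>x. (2 + expectation k) * indicator B (W x) \<partial>M)"
    proof (rule weighted_law_eq_if_char_eq)
      show "0 \<le> 2 + k x" for x using k[of x] by linarith
      have "\<bar>expectation k\<bar> \<le> expectation (\<lambda>x. 1)"
        using k by (intro order_trans[OF integral_abs_bound] integral_mono) (auto intro: ik)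
      then show "0 \<le> 2 + expectation k" by (simp add: prob_space)
      show "(CLINT x|M. of_real (2 + k x) * iexp (b * W x))
          = (CLINT x|M. of_real (2 + expectation k) * iexp (b * W x))" for b
      proof -
        have iW: "integrable M (\<lambda>x. iexp (b * W x))"
          by (rule int[of _ 1]) (auto simp del: of_real_mult)
        have ikW: "integrable M (\<lambda>x. of_real (k x) * iexp (b * W x))"
          by (rule int[of _ 1]) (auto simp: norm_mult k simp del: of_real_mult)
        show ?thesis using iW ikW kW[of b] by (simp add: distrib_right)
      qed
    qed (auto intro: ik)
    moreover have "integrable M (\<lambda>x. indicator B (W x) :: real)"
      by (rule int[of _ 1]) (auto split: split_indicator)
    moreover have "integrable M (\<lambda>x. k x * indicator B (W x))"
      by (rule int[of _ 1]) (use k in \<open>auto split: split_indicator\<close>)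
    ultimately have "expectation (\<lambda>x. k x * indicator B (W x))
        = expectation k * expectation (\<lambda>x. indicator B (W x))"
      by (simp add: distrib_right)
    then show ?thesis unfolding k_def[abs_def] .
  qed
  have step2: "(CLINT x|M. of_real (indicator B (W x)) * iexp (a * U x))
      = (CLINT x|M. of_real (expectation (\<lambda>x. indicator B (W x))) * iexp (a * U x))"
    if [measurable]: "B \<in> sets borel" for a B
  proof (rule complex_eqI)
    have i1: "integrable M (\<lambda>x. complex_of_real (indicator B (W x)) * iexp (a * U x))"
      by (rule int[of _ 1]) (auto simp: norm_mult split: split_indicator simp del: of_real_mult)
    have i2: "integrable M (\<lambda>x. iexp (a * U x))"
      by (rule int[of _ 1]) (auto simp del: of_real_mult)
    show "Re (CLINT x|M. of_real (indicator B (W x)) * iexp (a * U x))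
       = Re (CLINT x|M. of_real (expectation (\<lambda>x. indicator B (W x))) * iexp (a * U x))"
      using i1 i2 step1[OF that, of a 0]
      by (subst (1 2) integral_Re[symmetric]) (auto simp: Re_exp mult.commute)
    show "Im (CLINT x|M. of_real (indicator B (W x)) * iexp (a * U x))
       = Im (CLINT x|M. of_real (expectation (\<lambda>x. indicator B (W x))) * iexp (a * U x))"
      using i1 i2 step1[OF that, of a "- pi / 2"]
      by (subst (1 2) integral_Im[symmetric]) (auto simp: Im_exp mult.commute cos_diff)
  qed
  have product: "prob (U -` A \<inter> W -` B \<inter> space M) = prob (U -` A \<inter> space M) * prob (W -` B \<inter> space M)"
    if [measurable]: "A \<in> sets borel" "B \<in> sets borel" for A B
  proof -
    have "(\<integral>x. (indicator B (W x) :: real) * indicator A (U x) \<partial>M)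
        = (\<integral>x. expectation (\<lambda>x. indicator B (W x)) * indicator A (U x) \<partial>M)"
      by (rule weighted_law_eq_if_char_eq[OF _ _ _ _ _ step2])
         (auto intro!: int[of _ 1] split: split_indicator)
    moreover have "(\<lambda>x. indicator B (W x) * indicator A (U x) :: real)
        = indicator (U -` A \<inter> W -` B)" "(\<lambda>x. indicator B (W x) :: real) = indicator (W -` B)"
      "(\<lambda>x. indicator A (U x) :: real) = indicator (U -` A)"
      by (auto split: split_indicator)
    ultimately show ?thesis by (simp add: Int_commute mult.commute)
  qed
  have "distr M borel U \<Otimes>\<^sub>M distr M borel W = distr M (borel \<Otimes>\<^sub>M borel) (\<lambda>x. (U x, W x))"
  proof (rule pair_measure_eqI)
    interpret U: prob_space "distr M borel U" by (rule prob_space_distr) simp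
    interpret W: prob_space "distr M borel W" by (rule prob_space_distr) simp
    show "sigma_finite_measure (distr M borel U)" "sigma_finite_measure (distr M borel W)"
      by unfold_locales
    show "emeasure (distr M borel U) A * emeasure (distr M borel W) B
      = emeasure (distr M (borel \<Otimes>\<^sub>M borel) (\<lambda>x. (U x, W x))) (A \<times> B)"
      if "A \<in> sets (distr M borel U)" "B \<in> sets (distr M borel W)" for A B
    proof -
      have [measurable]: "A \<in> sets borel" "B \<in> sets borel" using that by auto
      have "(\<lambda>x. (U x, W x)) -` (A \<times> B) \<inter> space M = U -` A \<inter> W -` B \<inter> space M" by auto
      then show ?thesis
        using product[of A B]
        by (simp add: emeasure_distr emeasure_eq_measure ennreal_mult[symmetric])
    qed
  qed simp
  then show ?thesis by (simp add: indep_var_distribution_eq)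
qed

section \<open>Half-line events of a Gaussian pair\<close>

lemma (in prob_space) expectation_iexp_gaussian_rv:
  assumes Z: "gaussian_rv M Z" and mean: "expectation Z = 0" and var: "expectation (\<lambda>x. (Z x)\<^sup>2) = v"
  shows "(CLINT x|M. iexp (Z x)) = of_real (exp (- v / 2))"
proof -
  have [measurable]: "Z \<in> borel_measurable M" using Z by (simp add: gaussian_rv_def)
  consider (normal) m \<sigma> where "\<sigma> > 0" "distributed M lborel Z (normal_density m \<sigma>)"
    | (const) m where "AE \<omega> in M. Z \<omega> = m"
    using Z by (auto simp: gaussian_rv_def)
  then show ?thesis
  proof cases
    case normal
    have "m = 0" using normal_distributed_expectation[OF normal] mean by simp
    have "v = \<sigma>\<^sup>2" using normal_distributed_variance[OF normal] mean var by simp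
    have "distributed M lborel (\<lambda>x. (Z x - 0) / \<sigma>) std_normal_density"
      using normal normal_standard_normal_convert[of \<sigma> Z 0] \<open>m = 0\<close> by simp
    then have "distr M lborel (\<lambda>x. Z x / \<sigma>) = std_normal_distribution"
      by (simp add: distributed_distr_eq_density)
    then have "char (distr M lborel (\<lambda>x. Z x / \<sigma>)) \<sigma> = of_real (exp (- \<sigma>\<^sup>2 / 2))"
      by (simp add: char_std_normal_distribution)
    moreover have "char (distr M lborel (\<lambda>x. Z x / \<sigma>)) \<sigma> = (CLINT x|M. iexp (\<sigma> * (Z x / \<sigma>)))"
      unfolding char_def by (subst integral_distr) auto
    ultimately show ?thesis using normal \<open>v = \<sigma>\<^sup>2\<close> by simp
  next
    case const
    have "expectation Z = expectation (\<lambda>_. m)" using const by (intro integral_cong_AE) auto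
    then have "m = 0" using mean by (simp add: prob_space)
    have "v = expectation (\<lambda>_. 0)" unfolding var[symmetric]
      using const \<open>m = 0\<close> by (intro integral_cong_AE) auto
    moreover have "(CLINT x|M. iexp (Z x)) = (CLINT x|M. 1)"
      using const \<open>m = 0\<close> by (intro integral_cong_AE) auto
    ultimately show ?thesis by (simp add: prob_space)
  qed
qed

lemma (in prob_space) distr_std_normal_if_char:
  fixes Z :: "'a \<Rightarrow> real"
  assumes [measurable]: "Z \<in> borel_measurable M"
    and "\<And>t. (CLINT x|M. iexp (t * Z x)) = of_real (exp (- t\<^sup>2 / 2))"
  shows "distr M borel Z = std_normal_distribution"
  using assms(2)
  by (intro Levy_uniqueness real_distribution_distr real_dist_normal_dist)
     (auto simp: char_std_normal_distribution char_def integral_distr)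

lemma (in prob_space) expectation_indicator:
  assumes [measurable]: "Z \<in> borel_measurable M" "A \<in> sets borel"
  shows "expectation (\<lambda>x. indicator A (Z x)) = measure (distr M borel Z) A"
proof -
  have "(\<lambda>x. indicator A (Z x) :: real) = indicator (Z -` A)" by (auto split: split_indicator)
  then show ?thesis by (simp add: measure_distr)
qed

lemma emeasure_std_normal_le: 
  assumes "A \<subseteq> {c - \<delta>..c + \<delta>}" "0 \<le> \<delta>"
  shows "emeasure std_normal_distribution A \<le> ennreal \<delta>"
proof -
  have half: "std_normal_density x \<le> 1 / 2" for x
  proof -
    have "2 \<le> sqrt (2 * pi)" using pi_ge_two by (intro real_le_rsqrt) simp
    then have "1 / sqrt (2 * pi) * exp (- x\<^sup>2 / 2) \<le> 1 / 2 * 1"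
      by (intro mult_mono) (auto simp: field_simps)
    then show ?thesis by (simp add: std_normal_density_def)
  qed
  have "emeasure std_normal_distribution A \<le> emeasure std_normal_distribution {c - \<delta>..c + \<delta>}"
    using assms by (intro emeasure_mono) auto
  also have "\<dots> = (\<integral>\<^sup>+x. ennreal (std_normal_density x) * indicator {c - \<delta>..c + \<delta>} x \<partial>lborel)"
    by (subst emeasure_density) auto
  also have "\<dots> \<le> (\<integral>\<^sup>+x. ennreal (1 / 2) * indicator {c - \<delta>..c + \<delta>} x \<partial>lborel)"
    using half by (intro nn_integral_mono mult_right_mono ennreal_leI) auto
  also have "\<dots> = ennreal \<delta>"
    using assms(2) by (simp add: nn_integral_cmult ennreal_mult[symmetric] del: ennreal_half)
  finally show ?thesis .
qed

lemma measure_std_normal_interval_ge: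
  assumes "a \<le> b" "\<bar>a\<bar> \<le> c" "\<bar>b\<bar> \<le> c"
  shows "(b - a) * std_normal_density c \<le> measure std_normal_distribution {a<..b}"
proof -
  interpret N: prob_space std_normal_distribution by (rule prob_space_normal_density) simp
  have dens: "std_normal_density c \<le> std_normal_density x" if "x \<in> {a<..b}" for x
  proof -
    have "\<bar>x\<bar> \<le> \<bar>c\<bar>" using that assms by auto
    then have "x\<^sup>2 \<le> c\<^sup>2" by (simp add: abs_le_square_iff)
    then show ?thesis by (simp add: std_normal_density_def divide_right_mono)
  qed
  have "ennreal ((b - a) * std_normal_density c)
      = (\<integral>\<^sup>+x. ennreal (std_normal_density c) * indicator {a<..b} x \<partial>lborel)"
    using assms by (simp add: nn_integral_cmult ennreal_mult mult.commute)
  also have "\<dots> \<le> (\<integral>\<^sup>+x. ennreal (std_normal_density x) * indicator {a<..b} x \<partial>lborel)"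
    using dens by (intro nn_integral_mono) (auto split: split_indicator intro: ennreal_leI)
  also have "\<dots> = ennreal (measure std_normal_distribution {a<..b})"
    by (simp add: N.emeasure_eq_measure[symmetric] emeasure_density)
  finally show ?thesis by (simp add: ennreal_le_iff)
qed

lemma nn_integral_abs_std_normal_le: "(\<integral>\<^sup>+u. ennreal \<bar>u\<bar> \<partial>std_normal_distribution) \<le> 1"
proof -
  have "(\<integral>\<^sup>+u. ennreal \<bar>u\<bar> \<partial>std_normal_distribution)
      = (\<integral>\<^sup>+u. ennreal (std_normal_density u * \<bar>u\<bar> ^ (2 * 0 + 1)) \<partial>lborel)"
    by (subst nn_integral_density) (auto simp: ennreal_mult)
  also have "\<dots> = ennreal (\<integral>u. std_normal_density u * \<bar>u\<bar> ^ (2 * 0 + 1) \<partial>lborel)"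
    by (intro nn_integral_eq_integral integrable_std_normal_moment_abs) auto
  also have "\<dots> = ennreal (sqrt (2 / pi))"
    by (subst integral_std_normal_moment_abs_odd) simp
  also have "\<dots> \<le> 1"
    using pi_ge_two by (simp add: ennreal_le_1)
  finally show ?thesis .
qed

text \<open>Upward or downward closed, so that the exceedance events of increasing and of decreasing functions
are treated together; the empty set and the whole line are included.\<close>

definition half_line_set :: "real set \<Rightarrow> bool" where
  "half_line_set B \<longleftrightarrow> (\<forall>x y. x < y \<longrightarrow> x \<in> B \<longrightarrow> y \<in> B) \<or> (\<forall>x y. x < y \<longrightarrow> y \<in> B \<longrightarrow> x \<in> B)"

text \<open>Shifting by \<open>d\<close> can change membership in a half line only within distance \<open>\<bar>d\<bar>\<close> of its end
point: if \<open>s w'\<close> exceeds \<open>s w\<close> by more than \<open>\<bar>d\<bar>\<close>, then both arguments belonging to \<open>w'\<close> lie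
above both belonging to \<open>w\<close>, and \<open>w\<close>, \<open>w'\<close> cannot both see a change.\<close>

lemma half_line_set_shift_diff_subset:
  assumes B: "half_line_set B" and s: "s > 0"
  obtains c where "{w. (d + s * w \<in> B) \<noteq> (s * w \<in> B)} \<subseteq> {c - \<bar>d\<bar> / s..c + \<bar>d\<bar> / s}"
proof -
  let ?D = "{w. (d + s * w \<in> B) \<noteq> (s * w \<in> B)}"
  have far: False if "w \<in> ?D" "w' \<in> ?D" "w' > w + \<bar>d\<bar> / s" for w w'
  proof -
    have "s * w' > s * w + \<bar>d\<bar>" using that(3) s by (simp add: field_simps)
    then have "s * w < s * w'" "s * w < d + s * w'" "d + s * w < s * w'" "d + s * w < d + s * w'"
      by auto
    then show False using that(1,2) B unfolding half_line_set_def by blast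
  qed
  show ?thesis
  proof (cases "?D = {}")
    case True
    then show ?thesis using that by blast
  next
    case False
    then obtain c where "c \<in> ?D" by blast
    then have "?D \<subseteq> {c - \<bar>d\<bar> / s..c + \<bar>d\<bar> / s}"
      using far[of c] far[of _ c] by (force simp: not_less[symmetric] algebra_simps)
    then show ?thesis by (rule that)
  qed
qed

locale std_gaussian_pair = prob_space +
  fixes U V :: "'a \<Rightarrow> real" and r :: real
  assumes gaussian: "gaussian_rv M (\<lambda>x. a * U x + b * V x)"
    and square_integrable: "integrable M (\<lambda>x. (U x)\<^sup>2)" "integrable M (\<lambda>x. (V x)\<^sup>2)"
    and mean: "expectation U = 0" "expectation V = 0"
    and var: "expectation (\<lambda>x. (U x)\<^sup>2) = 1" "expectation (\<lambda>x. (V x)\<^sup>2) = 1"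
    and corr: "expectation (\<lambda>x. U x * V x) = r"
    and abs_corr_less: "\<bar>r\<bar> < 1"
begin

text \<open>\<open>W\<close> is the normalized residual of the linear regression of \<open>V\<close> on \<open>U\<close>, and \<open>s\<close> is its
standard deviation before normalization.\<close>
definition s :: real where "s = sqrt (1 - r\<^sup>2)"
definition W :: "'a \<Rightarrow> real" where "W x = (V x - r * U x) / s"

lemma s_pos: "s > 0" and s_le: "s \<le> 1" and s_sq: "s\<^sup>2 = 1 - r\<^sup>2"
  using abs_corr_less by (auto simp: s_def abs_square_less_1 less_imp_le)

lemma measurable_UVW[measurable]:
  "U \<in> borel_measurable M" "V \<in> borel_measurable M" "W \<in> borel_measurable M"
proof -
  show [measurable]: "U \<in> borel_measurable M"
    using gaussian[of 1 0] by (simp add: gaussian_rv_def)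
  show [measurable]: "V \<in> borel_measurable M"
    using gaussian[of 0 1] by (simp add: gaussian_rv_def)
  show "W \<in> borel_measurable M" unfolding W_def by measurable
qed

lemma V_decomp: "V x = r * U x + s * W x"
  using s_pos by (simp add: W_def)

text \<open>Joint Gaussianity enters through its linear combinations: each is Gaussian, so its mean and
variance determine the characteristic function.\<close>

lemma char_linear_combination:
  "(CLINT x|M. iexp (a * U x + b * V x)) = of_real (exp (- (a\<^sup>2 + b\<^sup>2 + 2 * a * b * r) / 2))"
proof (rule expectation_iexp_gaussian_rv[OF gaussian])
  have U: "integrable M U" and V: "integrable M V"
    using square_integrable by (auto intro: square_integrable_imp_integrable)
  have UV: "integrable M (\<lambda>x. U x * V x)"
  proof (rule Bochner_Integration.integrable_bound)
    show "integrable M (\<lambda>x. (U x)\<^sup>2 + (V x)\<^sup>2)" using square_integrable by auto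
    have "norm (U x * V x) \<le> norm ((U x)\<^sup>2 + (V x)\<^sup>2)" for x
    proof -
      have "2 * (\<bar>U x\<bar> * \<bar>V x\<bar>) \<le> (U x)\<^sup>2 + (V x)\<^sup>2"
        using sum_squares_bound[of "\<bar>U x\<bar>" "\<bar>V x\<bar>"] by (simp add: mult.assoc)
      moreover have "0 \<le> \<bar>U x\<bar> * \<bar>V x\<bar>" by simp
      ultimately have "\<bar>U x\<bar> * \<bar>V x\<bar> \<le> (U x)\<^sup>2 + (V x)\<^sup>2" by linarith
      then show ?thesis by (simp add: abs_mult)
    qed
    then show "AE x in M. norm (U x * V x) \<le> norm ((U x)\<^sup>2 + (V x)\<^sup>2)" by simp
  qed simp
  show "expectation (\<lambda>x. a * U x + b * V x) = 0"
    using U V mean by simp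
  have "expectation (\<lambda>x. (a * U x + b * V x)\<^sup>2)
      = expectation (\<lambda>x. a\<^sup>2 * (U x)\<^sup>2 + b\<^sup>2 * (V x)\<^sup>2 + 2 * a * b * (U x * V x))"
    by (intro Bochner_Integration.integral_cong) (auto simp: power2_eq_square algebra_simps)
  also have "\<dots> = a\<^sup>2 + b\<^sup>2 + 2 * a * b * r"
    using UV square_integrable var corr by simp
  finally show "expectation (\<lambda>x. (a * U x + b * V x)\<^sup>2) = a\<^sup>2 + b\<^sup>2 + 2 * a * b * r" .
qed

lemma char_UW: "(CLINT x|M. iexp (a * U x + b * W x)) = of_real (exp (- (a\<^sup>2 + b\<^sup>2) / 2))"
proof -
  have "a * U x + b * W x = (a - b * r / s) * U x + (b / s) * V x" for x
    using s_pos by (simp add: W_def field_simps)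
  moreover have "(a - b * r / s)\<^sup>2 + (b / s)\<^sup>2 + 2 * (a - b * r / s) * (b / s) * r
      = a\<^sup>2 + b\<^sup>2 * ((1 - r\<^sup>2) / s\<^sup>2)"
    by (simp add: power2_eq_square algebra_simps add_divide_distrib diff_divide_distrib)
  moreover have "(1 - r\<^sup>2) / s\<^sup>2 = 1" using s_pos by (simp flip: s_sq)
  ultimately show ?thesis
    using char_linear_combination[of "a - b * r / s" "b / s"] by simp
qed

lemma distr_U: "distr M borel U = std_normal_distribution"
  using char_UW[of _ 0] by (intro distr_std_normal_if_char) simp_all

lemma distr_W: "distr M borel W = std_normal_distribution"
  using char_UW[of 0] by (intro distr_std_normal_if_char) simp_all

lemma distr_V: "distr M borel V = std_normal_distribution"
  using char_linear_combination[of 0] by (intro distr_std_normal_if_char) simp_all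

lemma indep_UW: "indep_var borel U borel W"
proof (rule indep_var_if_char_factorizes)
  show "(CLINT x|M. iexp (a * U x + b * W x))
      = (CLINT x|M. iexp (a * U x)) * (CLINT x|M. iexp (b * W x))" for a b
    unfolding char_UW using char_UW[of a 0] char_UW[of 0 b]
    by (simp add: exp_add[symmetric] add_divide_distrib[symmetric] flip: of_real_mult)
qed simp_all

lemma expectation_indicator_UW:
  assumes [measurable]: "A \<in> sets borel" "B \<in> sets borel"
  shows "expectation (\<lambda>x. indicator A (U x) * indicator B (W x))
    = measure std_normal_distribution A * measure std_normal_distribution B"
proof -
  have "expectation (\<lambda>x. indicator A (U x) * indicator B (W x))
      = expectation (\<lambda>x. indicator A (U x)) * expectation (\<lambda>x. indicator B (W x) :: real)"
    using indep_var_compose[OF indep_UW, of "indicator A" borel "indicator B" borel]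
    by (intro indep_var_lebesgue_integral integrable_const_bound[of _ 1])
       (auto simp: comp_def split: split_indicator)
  also have "\<dots> = measure std_normal_distribution A * measure std_normal_distribution B"
    by (simp add: expectation_indicator distr_U distr_W)
  finally show ?thesis .
qed

text \<open>Given \<open>U = u\<close>, passing from \<open>s W\<close> to \<open>V = r u + s W\<close> matters only for \<open>W\<close> in an interval
of half-length \<open>\<bar>r u\<bar> / s\<close>, which has at most this probability as \<open>\<phi> \<le> 1 / 2\<close>;
now average over \<open>u\<close>, using \<open>E \<bar>U\<bar> \<le> 1\<close>.\<close>

lemma expectation_indicator_diff_le:
  assumes B: "half_line_set B" and [measurable]: "B \<in> sets borel"
  shows "expectation (\<lambda>x. \<bar>indicator B (V x) - indicator B (s * W x)\<bar>) \<le> \<bar>r\<bar> / s"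
proof -
  define D where "D = {p. (r * fst p + s * snd p \<in> B) \<noteq> (s * snd p \<in> B)}"
  have [measurable]: "D \<in> sets (borel \<Otimes>\<^sub>M borel)" 
  proof -
    have "{p \<in> space (borel \<Otimes>\<^sub>M borel). (r * fst p + s * snd p \<in> B) \<noteq> (s * snd p \<in> B)} \<in> sets (borel \<Otimes>\<^sub>M borel)"
      by measurable
    then show ?thesis by (simp add: D_def space_pair_measure)
  qed
  interpret N: prob_space std_normal_distribution by (rule prob_space_normal_density) simp
  have "ennreal (expectation (\<lambda>x. \<bar>indicator B (V x) - indicator B (s * W x)\<bar>))
      = (\<integral>\<^sup>+x. ennreal \<bar>indicator B (V x) - indicator B (s * W x)\<bar> \<partial>M)"
    by (intro nn_integral_eq_integral[symmetric] integrable_const_bound[of _ 1])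
       (auto split: split_indicator)
  also have "\<dots> = (\<integral>\<^sup>+x. indicator D (U x, W x) \<partial>M)"
    by (intro nn_integral_cong) (auto simp: D_def V_decomp split: split_indicator)
  also have "\<dots> = (\<integral>\<^sup>+p. indicator D p \<partial>distr M (borel \<Otimes>\<^sub>M borel) (\<lambda>x. (U x, W x)))"
    by (subst nn_integral_distr) auto
  also have "distr M (borel \<Otimes>\<^sub>M borel) (\<lambda>x. (U x, W x))
      = std_normal_distribution \<Otimes>\<^sub>M std_normal_distribution"
    using indep_UW by (simp add: indep_var_distribution_eq distr_U distr_W)
  also have "(\<integral>\<^sup>+p. indicator D p \<partial>(std_normal_distribution \<Otimes>\<^sub>M std_normal_distribution))
      = (\<integral>\<^sup>+u. emeasure std_normal_distribution (Pair u -` D) \<partial>std_normal_distribution)"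
    by (simp add: N.emeasure_pair_measure_alt cong: measurable_cong_sets sets_pair_measure_cong)
  also have "\<dots> \<le> (\<integral>\<^sup>+u. ennreal (\<bar>r\<bar> / s) * ennreal \<bar>u\<bar> \<partial>std_normal_distribution)"
  proof (rule nn_integral_mono)
    fix u
    obtain c where c: "{w. (r * u + s * w \<in> B) \<noteq> (s * w \<in> B)}
        \<subseteq> {c - \<bar>r * u\<bar> / s..c + \<bar>r * u\<bar> / s}"
      using half_line_set_shift_diff_subset[OF B s_pos] .
    then have "emeasure std_normal_distribution (Pair u -` D) \<le> ennreal (\<bar>r * u\<bar> / s)"
      using s_pos by (intro emeasure_std_normal_le[of _ c]) (auto simp: D_def)
    also have "\<bar>r * u\<bar> / s = \<bar>r\<bar> / s * \<bar>u\<bar>" by (simp add: abs_mult)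
    finally show "emeasure std_normal_distribution (Pair u -` D) \<le> ennreal (\<bar>r\<bar> / s) * ennreal \<bar>u\<bar>"
      using s_pos by (simp add: ennreal_mult[symmetric])
  qed
  also have "\<dots> = ennreal (\<bar>r\<bar> / s) * (\<integral>\<^sup>+u. ennreal \<bar>u\<bar> \<partial>std_normal_distribution)"
    by (intro nn_integral_cmult) simp
  also have "\<dots> \<le> ennreal (\<bar>r\<bar> / s) * 1"
    by (intro mult_left_mono nn_integral_abs_std_normal_le) simp
  finally show ?thesis using s_pos by simp
qed

text \<open>By independence the indicator of \<open>s W \<in> B\<close> is uncorrelated with every event of \<open>U\<close>, so it may be
subtracted in the second factor.\<close>

lemma covariance_indicator:
  assumes [measurable]: "A \<in> sets borel" "B \<in> sets borel"
  shows "covariance M (\<lambda>x. indicator A (U x)) (\<lambda>x. indicator B (V x))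
    = expectation (\<lambda>x. indicator A (U x) * (indicator B (V x) - indicator B (s * W x)))
      - expectation (\<lambda>x. indicator A (U x)) * expectation (\<lambda>x. indicator B (V x) - indicator B (s * W x))"
proof -
  have int: "integrable M f" if "f \<in> borel_measurable M" "\<And>x. \<bar>f x\<bar> \<le> 1" for f :: "'a \<Rightarrow> real"
    using that by (intro integrable_const_bound[of _ 1]) auto
  define a v w :: "'a \<Rightarrow> real" where "a x = indicator A (U x)" and "v x = indicator B (V x)"
    and "w x = indicator B (s * W x)" for x
  have [measurable]: "a \<in> borel_measurable M" "v \<in> borel_measurable M" "w \<in> borel_measurable M"
    unfolding a_def v_def w_def by measurable
  have ints: "integrable M a" "integrable M v" "integrable M w"
    "integrable M (\<lambda>x. a x * v x)" "integrable M (\<lambda>x. a x * w x)"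
    by (auto intro!: int simp: a_def v_def w_def split: split_indicator)
  have "covariance M a v = expectation (\<lambda>x. a x * v x - expectation v * a x
      - expectation a * v x + expectation a * expectation v)"
    unfolding covariance_def by (intro Bochner_Integration.integral_cong) (auto simp: algebra_simps)
  also have "\<dots> = expectation (\<lambda>x. a x * v x) - expectation a * expectation v"
    using ints by (simp add: prob_space)
  finally have cov: "covariance M a v = expectation (\<lambda>x. a x * v x) - expectation a * expectation v" .
  have "expectation (\<lambda>x. a x * w x) = expectation a * expectation w"
    unfolding a_def w_def
    using indep_var_compose[OF indep_UW, of "indicator A" borel "\<lambda>z. indicator B (s * z)" borel]
    by (intro indep_var_lebesgue_integral int) (auto simp: comp_def split: split_indicator)
  with cov have "covariance M a v = expectation (\<lambda>x. a x * (v x - w x))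
      - expectation a * expectation (\<lambda>x. v x - w x)"
    using ints by (simp add: right_diff_distrib)
  then show ?thesis unfolding a_def v_def w_def .
qed

text \<open>For \<open>\<bar>r\<bar> \<le> 1 / 2\<close> the factor \<open>1 / s\<close> in the comparison of \<open>V\<close> with \<open>s W\<close> is at
most \<open>2\<close>; for larger \<open>\<bar>r\<bar>\<close> the claim is weaker than the trivial bound by \<open>2\<close>.\<close>

lemma abs_covariance_indicator_le:
  assumes [measurable]: "A \<in> sets borel" "B \<in> sets borel" and B: "half_line_set B"
  shows "\<bar>covariance M (\<lambda>x. indicator A (U x)) (\<lambda>x. indicator B (V x))\<bar> \<le> 4 * \<bar>r\<bar>"
proof -
  define a d :: "'a \<Rightarrow> real" where "a x = indicator A (U x)"
    and "d x = indicator B (V x) - indicator B (s * W x)" for x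
  have [measurable]: "a \<in> borel_measurable M" "d \<in> borel_measurable M"
    unfolding a_def d_def by measurable
  have bounds: "0 \<le> a x" "a x \<le> 1" "\<bar>d x\<bar> \<le> 1" for x
    by (auto simp: a_def d_def split: split_indicator)
  have int: "integrable M f" if "f \<in> borel_measurable M" "\<And>x. \<bar>f x\<bar> \<le> 1" for f :: "'a \<Rightarrow> real"
    using that by (intro integrable_const_bound[of _ 1]) auto
  have ints: "integrable M a" "integrable M d" "integrable M (\<lambda>x. \<bar>d x\<bar>)" "integrable M (\<lambda>x. a x * d x)"
    "integrable M (\<lambda>x. a x * \<bar>d x\<bar>)"
    using bounds by (auto intro!: int mult_le_one simp: abs_mult)
  define e where "e = expectation (\<lambda>x. \<bar>d x\<bar>)"
  have e1: "e \<le> 1"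
    using integral_mono[OF ints(3), of "\<lambda>_. 1"] bounds by (simp add: e_def prob_space)
  have "\<bar>expectation (\<lambda>x. a x * d x)\<bar> \<le> e"
    unfolding e_def
    by (rule order_trans[OF integral_abs_bound], rule integral_mono)
       (use bounds in \<open>auto intro!: ints integrable_abs mult_left_le_one_le simp: abs_mult\<close>)
  moreover have "\<bar>expectation a * expectation d\<bar> \<le> 1 * e"
    unfolding abs_mult
  proof (rule mult_mono)
    have "expectation a \<le> 1"
      using integral_mono[OF ints(1), of "\<lambda>_. 1"] bounds by (simp add: prob_space)
    moreover have "expectation a \<ge> 0" using bounds by (intro integral_nonneg_AE) auto
    ultimately show "\<bar>expectation a\<bar> \<le> 1" by simp
    show "\<bar>expectation d\<bar> \<le> e" unfolding e_def by (rule integral_abs_bound)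
  qed auto
  ultimately have le: "\<bar>expectation (\<lambda>x. a x * d x) - expectation a * expectation d\<bar> \<le> 2 * e"
    by linarith
  have "2 * e \<le> 4 * \<bar>r\<bar>"
  proof (cases "\<bar>r\<bar> \<le> 1 / 2")
    case True
    then have "r\<^sup>2 \<le> (1 / 2)\<^sup>2" by (subst abs_le_square_iff[symmetric]) simp
    then have "1 / 2 \<le> s" unfolding s_def by (intro real_le_rsqrt) (simp add: power2_eq_square)
    then have "\<bar>r\<bar> / s \<le> \<bar>r\<bar> / (1 / 2)" by (intro divide_left_mono) auto
    moreover have "e \<le> \<bar>r\<bar> / s"
      using expectation_indicator_diff_le[OF B] by (simp add: e_def d_def)
    ultimately show ?thesis by simp
  next
    case False
    then show ?thesis using e1 by simp
  qed
  then show ?thesis using le unfolding a_def d_def by (subst covariance_indicator) simp_all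
qed

text \<open>As \<open>V\<close> and \<open>s W\<close> are positive with equal probability, the covariance is
\<open>E (1 (U > 0) (1 (V > 0) - 1 (s W > 0)))\<close>. For \<open>U > 0\<close> the difference has the sign of \<open>r\<close> or
vanishes, and it is nonzero at least when \<open>1 < U \<le> 2\<close> and \<open>W\<close> lies in an interval of length
\<open>\<bar>r\<bar>\<close> next to \<open>0\<close>.\<close>

lemma abs_covariance_positive_ge:
  "std_normal_density 1 * std_normal_density 2 * \<bar>r\<bar>
    \<le> \<bar>covariance M (\<lambda>x. indicator {0<..} (U x)) (\<lambda>x. indicator {0<..} (V x))\<bar>"
proof -
  let ?N = std_normal_distribution
  define a d :: "'a \<Rightarrow> real" where "a x = indicator {0<..} (U x)"
    and "d x = indicator {0<..} (V x) - indicator {0<..} (s * W x)" for x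
  \<comment> \<open>For \<open>W\<close> in \<open>J\<close> and \<open>U > 1\<close> exactly one of \<open>V\<close> and \<open>s W\<close> is positive.\<close>
  define J :: "real set" where "J = (if r \<ge> 0 then {- r<..0} else {0<..- r})"
  have [measurable]: "a \<in> borel_measurable M" "d \<in> borel_measurable M"
    unfolding a_def d_def by measurable
  have [measurable]: "J \<in> sets borel" by (simp add: J_def)
  have int: "integrable M f" if "f \<in> borel_measurable M" "\<And>x. \<bar>f x\<bar> \<le> 1" for f :: "'a \<Rightarrow> real"
    using that by (intro integrable_const_bound[of _ 1]) auto
  have ad: "integrable M (\<lambda>x. a x * d x)"
    by (rule int) (auto simp: a_def d_def split: split_indicator)
  have "expectation d = expectation (\<lambda>x. indicator {0<..} (V x)) - expectation (\<lambda>x. indicator {0<..} (W x))"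
    unfolding d_def using s_pos
    by (subst Bochner_Integration.integral_diff)
       (auto intro!: int Bochner_Integration.integral_cong split: split_indicator simp: zero_less_mult_iff)
  also have "\<dots> = 0"
    by (simp add: expectation_indicator distr_V distr_W)
  finally have cov: "covariance M (\<lambda>x. indicator {0<..} (U x)) (\<lambda>x. indicator {0<..} (V x))
      = expectation (\<lambda>x. a x * d x)"
    using covariance_indicator[of "{0<..}" "{0<..}"] by (simp add: a_def[abs_def] d_def[abs_def])
  have "std_normal_density 1 * std_normal_density 2 * \<bar>r\<bar>
      = (2 - 1) * std_normal_density 2 * (\<bar>r\<bar> * std_normal_density 1)" by simp
  also have "\<dots> \<le> measure ?N {1<..2} * measure ?N J"
  proof (intro mult_mono measure_std_normal_interval_ge)
    show "\<bar>r\<bar> * std_normal_density 1 \<le> measure ?N J"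
      using measure_std_normal_interval_ge[of "- r" 0 1] measure_std_normal_interval_ge[of 0 "- r" 1]
        abs_corr_less by (auto simp: J_def)
  qed auto
  also have "\<dots> = expectation (\<lambda>x. indicator {1<..2} (U x) * indicator J (W x))"
    by (rule expectation_indicator_UW[symmetric]) simp_all
  also have "\<dots> \<le> expectation (\<lambda>x. (if r \<ge> 0 then 1 else - 1) * (a x * d x))"
  proof (rule integral_mono)
    fix x
    have "s * \<bar>W x\<bar> \<le> 1 * \<bar>W x\<bar>" using s_le by (intro mult_right_mono) auto
    then have sW: "\<bar>s * W x\<bar> \<le> \<bar>W x\<bar>" using s_pos by (simp add: abs_mult)
    have sgn: "(0 < s * W x) = (0 < W x)" using s_pos by (simp add: zero_less_mult_iff)
    show "indicator {1<..2} (U x) * indicator J (W x) \<le> (if r \<ge> 0 then 1 else - 1) * (a x * d x)"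
    proof (cases "r \<ge> 0")
      case True
      have "0 < V x" if "1 < U x" "- r < W x" "W x \<le> 0"
      proof -
        have "r * 1 \<le> r * U x" using True that by (intro mult_left_mono) auto
        then show ?thesis using sW that unfolding V_decomp[of x] mult_1_right by linarith
      qed
      moreover have "0 < V x" if "0 < U x" "0 < W x"
      proof -
        have "0 \<le> r * U x" "0 < s * W x" using True that s_pos by auto
        then show ?thesis by (simp add: V_decomp)
      qed
      ultimately show ?thesis
        using True by (auto simp: a_def d_def J_def sgn split: split_indicator)
    next
      case False
      have "V x \<le> 0" if "1 < U x" "W x \<le> - r" "0 < W x"
      proof -
        have "r * U x \<le> r * 1" using False that by (intro mult_left_mono_neg) auto
        then show ?thesis using sW that unfolding V_decomp[of x] mult_1_right by linarith
      qed
      moreover have "V x \<le> 0" if "0 < U x" "W x \<le> 0"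
      proof -
        have "r * U x \<le> 0" "s * W x \<le> 0" using False that s_pos by (auto simp: mult_le_0_iff)
        then show ?thesis by (simp add: V_decomp)
      qed
      ultimately show ?thesis
        using False by (force simp: a_def d_def J_def sgn split: split_indicator)
    qed
  qed (auto intro!: int ad simp del: integral_mult_right_zero split: split_indicator)
  also have "\<dots> \<le> \<bar>expectation (\<lambda>x. a x * d x)\<bar>" by (auto simp: ad)
  finally show ?thesis by (simp add: cov)
qed

end

section \<open>Hermite coefficients and the generalized inverse\<close>

text \<open>If the integrand defining the coefficient fails to be integrable, its Bochner integral is \<open>0\<close>
and the bound holds as well.\<close>

lemma hermite_coeff_le:
  assumes "finite_measure \<mu>"
  shows "hermite_coeff G \<mu> k \<le> gauss_deriv_bound k * (measure \<mu> (space \<mu>))\<^sup>2"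
proof -
  interpret finite_measure \<mu> by fact
  let ?f = "\<lambda>u. indicator (range G) u *\<^sub>R (hermite k (gen_inverse G u) * std_normal_density (gen_inverse G u))"
  let ?b = "sqrt (gauss_deriv_bound k)"
  have f: "\<bar>?f u\<bar> \<le> ?b" for u
  proof -
    have "\<bar>gauss_deriv k y\<bar> \<le> ?b" for y
      using gauss_deriv_sq_le[of k y] real_sqrt_le_mono[of "(gauss_deriv k y)\<^sup>2"] by simp
    then show ?thesis
      by (auto simp: hermite_times_density abs_mult gauss_deriv_bound_nonneg split: split_indicator)
  qed
  have "\<bar>\<integral>u. ?f u \<partial>\<mu>\<bar> \<le> ?b * measure \<mu> (space \<mu>)"
  proof (cases "integrable \<mu> ?f")
    case True
    have "\<bar>\<integral>u. ?f u \<partial>\<mu>\<bar> \<le> (\<integral>u. \<bar>?f u\<bar> \<partial>\<mu>)" by (rule integral_abs_bound)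
    also have "\<dots> \<le> (\<integral>u. ?b \<partial>\<mu>)"
      using f integrable_abs[OF True] by (intro integral_mono) auto
    also have "\<dots> = ?b * measure \<mu> (space \<mu>)" by simp
    finally show ?thesis .
  next
    case False
    then show ?thesis by (simp add: not_integrable_integral_eq gauss_deriv_bound_nonneg)
  qed
  then have "(\<integral>u. ?f u \<partial>\<mu>)\<^sup>2 \<le> (?b * measure \<mu> (space \<mu>))\<^sup>2"
    by (subst abs_le_square_iff[symmetric]) (simp add: gauss_deriv_bound_nonneg)
  then show ?thesis
    by (simp add: hermite_coeff_def set_lebesgue_integral_def power_mult_distrib gauss_deriv_bound_nonneg)
qed

lemma gen_inverse_apply:
  assumes G: "strict_mono G"
  shows "gen_inverse G (G x) = x"
proof -
  have "{y. G y \<ge> G x} = {x..}" using strict_mono_less_eq[OF G] by auto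
  then show ?thesis using strict_mono_mono[OF G] by (simp add: gen_inverse_def)
qed

text \<open>The generalized inverse is monotone on the set \<open>S\<close> of levels that some value of \<open>G\<close> reaches
and some other value stays below; outside \<open>S\<close> its value is the infimum of the empty or of an
unbounded set. With the inverse \<open>g\<close> cut off outside \<open>S\<close>, the range of \<open>G\<close> is the Borel set of all \<open>u \<in> S\<close> with
\<open>G (g u) = u\<close>.\<close>

lemma measurable_gen_inverse_on_range:
  fixes f :: "real \<Rightarrow> real"
  assumes G: "strict_mono G" and [measurable]: "f \<in> borel_measurable borel"
  shows "(\<lambda>u. indicator (range G) u *\<^sub>R f (gen_inverse G u)) \<in> borel_measurable borel"
proof -
  have mG: "mono G" by (rule strict_mono_mono[OF G])
  have [measurable]: "G \<in> borel_measurable borel" by (rule borel_measurable_mono[OF mG])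
  define S where "S = (\<Union>n. {..G (real n)}) \<inter> (\<Union>n. {G (- real n)<..})"
  have S[measurable]: "S \<in> sets borel" unfolding S_def by measurable
  have "mono_on S (gen_inverse G)"
  proof (rule mono_onI)
    fix u v assume uv: "u \<in> S" "v \<in> S" "u \<le> v"
    from uv obtain n where n: "v \<le> G (real n)" by (auto simp: S_def)
    from uv obtain m where m: "G (- real m) < u" by (auto simp: S_def)
    have "bdd_below {x. G x \<ge> u}"
    proof (rule bdd_belowI[of _ "- real m"])
      fix x assume "x \<in> {x. G x \<ge> u}"
      with m have "G (- real m) < G x" by simp
      then show "- real m \<le> x" using strict_mono_less[OF G] by simp
    qed
    moreover have "{x. G x \<ge> v} \<noteq> {}" using n by blast
    ultimately have "Inf {x. G x \<ge> u} \<le> Inf {x. G x \<ge> v}"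
      using uv by (intro cInf_superset_mono) auto
    then show "gen_inverse G u \<le> gen_inverse G v" using mG by (simp add: gen_inverse_def)
  qed
  then have "gen_inverse G \<in> borel_measurable (restrict_space borel S)"
    by (rule borel_measurable_mono_on_fnc)
  then have "(\<lambda>u. indicator S u *\<^sub>R gen_inverse G u) \<in> borel_measurable borel"
    using S by (subst (asm) borel_measurable_restrict_space_iff) auto
  define g where "g u = indicator S u *\<^sub>R gen_inverse G u" for u
  have [measurable]: "g \<in> borel_measurable borel" unfolding g_def[abs_def] by fact
  have range_S: "u \<in> S" if "u \<in> range G" for u
  proof -
    obtain x where x: "u = G x" using \<open>u \<in> range G\<close> by blast
    obtain n where "x \<le> real n" using real_arch_simple by blast
    moreover obtain m where "- x < real m" using reals_Archimedean2 by blast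
    ultimately have "G x \<le> G (real n)" "G (- real m) < G x"
      using strict_mono_less[OF G] strict_mono_less_eq[OF G] by auto
    then show ?thesis by (auto simp: S_def x)
  qed
  have "range G = {u \<in> space borel. u \<in> S \<and> G (g u) = u}"
  proof (intro set_eqI iffI)
    fix u assume "u \<in> range G"
    then show "u \<in> {u \<in> space borel. u \<in> S \<and> G (g u) = u}"
      using range_S gen_inverse_apply[OF G] by (auto simp: g_def)
  next
    fix u assume "u \<in> {u \<in> space borel. u \<in> S \<and> G (g u) = u}"
    then have "G (g u) = u" by blast
    then show "u \<in> range G" by (rule range_eqI[OF sym])
  qed
  moreover have "{u \<in> space borel. u \<in> S \<and> G (g u) = u} \<in> sets borel" by measurable
  ultimately have [measurable]: "range G \<in> sets borel" by (simp only:)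
  have "(\<lambda>u. indicator (range G) u *\<^sub>R f (gen_inverse G u))
      = (\<lambda>u. indicator (range G) u *\<^sub>R f (g u))"
    using range_S by (auto simp: fun_eq_iff g_def split: split_indicator)
  moreover have "(\<lambda>u. indicator (range G) u *\<^sub>R f (g u)) \<in> borel_measurable borel"
    by measurable
  ultimately show ?thesis by (simp only:)
qed

text \<open>Decreasing functions are reduced to increasing ones by reflection.\<close>

lemma gen_inverse_uminus:
  assumes "\<forall>x y. x < y \<longrightarrow> G y < G x"
  shows "strict_mono (\<lambda>x. - G x)" and "gen_inverse G u = gen_inverse (\<lambda>x. - G x) (- u)"
proof -
  show *: "strict_mono (\<lambda>x. - G x)" using assms by (simp add: strict_mono_def)
  have "\<not> mono G" 
    using assms unfolding mono_def by (metis less_numeral_extra(1) less_imp_le not_less)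
  then show "gen_inverse G u = gen_inverse (\<lambda>x. - G x) (- u)"
    using strict_mono_mono[OF *] by (simp add: gen_inverse_def)
qed

text \<open>\<open>H 0 = 1\<close>, so the coefficient at a unit mass is the square of a value of \<open>\<phi>\<close>. Measurability
of the integrand has to be known here: otherwise its integral would be \<open>0\<close>.\<close>

lemma hermite_coeff_return_0_pos:
  assumes G: "strict_mono G \<or> (\<forall>x y. x < y \<longrightarrow> G y < G x)"
  shows "hermite_coeff G (return borel (G x)) 0 > 0"
proof -
  let ?f = "\<lambda>u. indicator (range G) u *\<^sub>R std_normal_density (gen_inverse G u)"
  have "?f \<in> borel_measurable borel"
    using G
  proof
    assume "strict_mono G"
    then show ?thesis by (rule measurable_gen_inverse_on_range) simp
  next
    assume G: "\<forall>x y. x < y \<longrightarrow> G y < G x"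
    let ?h = "\<lambda>u. indicator (range (\<lambda>x. - G x)) u *\<^sub>R std_normal_density (gen_inverse (\<lambda>x. - G x) u)"
    have h: "?h \<in> borel_measurable borel"
      by (intro measurable_gen_inverse_on_range gen_inverse_uminus[OF G]) simp
    have "?f = (\<lambda>u. ?h (- u))"
      by (auto simp: fun_eq_iff gen_inverse_uminus(2)[OF G] image_iff split: split_indicator)
    moreover have "(\<lambda>u. ?h (- u)) \<in> borel_measurable borel"
      by (rule measurable_compose[OF _ h]) simp
    ultimately show ?thesis by simp
  qed
  then have "(\<integral>u. ?f u \<partial>return borel (G x)) = ?f (G x)"
    by (intro integral_return) simp_all
  then have "hermite_coeff G (return borel (G x)) 0 = (std_normal_density (gen_inverse G (G x)))\<^sup>2"
    by (simp add: hermite_coeff_def set_lebesgue_integral_def hermite_times_density)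
  then show ?thesis using normal_density_pos[of 1 0 "gen_inverse G (G x)"] by simp
qed

section \<open>Exceedances of monotone functions and short range dependence\<close>

lemma borel_measurable_strictly_monotone:
  fixes G :: "real \<Rightarrow> real"
  assumes "strict_mono G \<or> (\<forall>x y. x < y \<longrightarrow> G y < G x)"
  shows "G \<in> borel_measurable borel"
  using assms
proof
  assume "strict_mono G"
  then show ?thesis by (intro borel_measurable_mono strict_mono_mono)
next
  assume "\<forall>x y. x < y \<longrightarrow> G y < G x"
  then have "(\<lambda>x. - G x) \<in> borel_measurable borel"
    by (intro borel_measurable_mono strict_mono_mono gen_inverse_uminus)
  then have "(\<lambda>x. - (- G x)) \<in> borel_measurable borel" by (rule borel_measurable_uminus)
  then show ?thesis by simp
qed

lemma (in std_gaussian_pair) std_gaussian_pair_uminus: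
  "std_gaussian_pair M (\<lambda>x. - U x) (\<lambda>x. - V x) r"
proof
  show "gaussian_rv M (\<lambda>x. a * - U x + b * - V x)" for a b
    using gaussian[of "- a" "- b"] by simp
qed (use square_integrable mean var corr abs_corr_less in simp_all)

lemma (in std_gaussian_pair) abs_covariance_exceedance_le:
  assumes G: "strict_mono G \<or> (\<forall>x y. x < y \<longrightarrow> G y < (G x :: real))"
  shows "\<bar>covariance M (\<lambda>x. indicator {u<..} (G (U x))) (\<lambda>x. indicator {v<..} (G (V x)))\<bar> \<le> 4 * \<bar>r\<bar>"
proof -
  have [measurable]: "G \<in> borel_measurable borel" using G by (rule borel_measurable_strictly_monotone)
  have m: "G -` {w<..} \<in> sets borel" for w
    using measurable_sets[of G borel borel "{w<..}"] by simp
  have "half_line_set (G -` {v<..})"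
    using G unfolding half_line_set_def strict_mono_def vimage_def
    by (auto intro: order.strict_trans)
  then have "\<bar>covariance M (\<lambda>x. indicator (G -` {u<..}) (U x)) (\<lambda>x. indicator (G -` {v<..}) (V x))\<bar> \<le> 4 * \<bar>r\<bar>"
    by (intro abs_covariance_indicator_le m)
  then show ?thesis by (simp add: indicator_vimage comp_def)
qed

lemma (in std_gaussian_pair) abs_covariance_exceedance_ge:
  assumes G: "strict_mono G \<or> (\<forall>x y. x < y \<longrightarrow> G y < (G x :: real))"
  shows "std_normal_density 1 * std_normal_density 2 * \<bar>r\<bar>
    \<le> \<bar>covariance M (\<lambda>x. indicator {G 0<..} (G (U x))) (\<lambda>x. indicator {G 0<..} (G (V x)))\<bar>"
  using G
proof
  assume "strict_mono G"
  then have "indicator {G 0<..} (G z) = (indicator {0<..} z :: real)" for z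
    by (auto simp: strict_mono_less split: split_indicator)
  then show ?thesis using abs_covariance_positive_ge by simp
next
  interpret neg: std_gaussian_pair M "\<lambda>x. - U x" "\<lambda>x. - V x" r
    by (rule std_gaussian_pair_uminus)
  assume "\<forall>x y. x < y \<longrightarrow> G y < G x"
  then have "G 0 < G z \<longleftrightarrow> z < 0" for z
    by (metis less_irrefl less_asym neq_iff)
  then have "indicator {G 0<..} (G z) = (indicator {0<..} (- z) :: real)" for z
    by (auto split: split_indicator)
  then show ?thesis using neg.abs_covariance_positive_ge by simp
qed

lemma stationary_field_compose:
  assumes Y: "stationary_field M T Y" and [measurable]: "G \<in> borel_measurable borel"
  shows "stationary_field M T (\<lambda>t \<omega>. G (Y t \<omega>))"
  unfolding stationary_field_def
proof (intro conjI allI impI)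
  have Ym: "Y t \<in> borel_measurable M" if "t \<in> T" for t
    using Y that by (auto simp: stationary_field_def random_field_def)
  then show "random_field M T (\<lambda>t \<omega>. G (Y t \<omega>))"
    by (auto simp: random_field_def)
  fix I h assume I: "finite I" "I \<subseteq> T" "\<forall>t\<in>I. t + h \<in> T"
  let ?P = "\<Pi>\<^sub>M t\<in>I. (borel :: real measure)"
  have map: "distr M ?P (\<lambda>\<omega>. \<lambda>t\<in>I. G (Y (t + k) \<omega>))
      = distr (distr M ?P (\<lambda>\<omega>. \<lambda>t\<in>I. Y (t + k) \<omega>)) ?P (\<lambda>y. \<lambda>t\<in>I. G (y t))"
    if k: "\<forall>t\<in>I. t + k \<in> T" for k
  proof -
    have "(\<lambda>\<omega>. \<lambda>t\<in>I. Y (t + k) \<omega>) \<in> measurable M ?P"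
      using k by (intro measurable_restrict Ym) auto
    moreover have "(\<lambda>y. \<lambda>t\<in>I. G (y t)) \<in> measurable ?P ?P" by measurable
    ultimately show ?thesis
      by (subst distr_distr) (auto simp: comp_def intro!: distr_cong)
  qed
  have "distr M ?P (\<lambda>\<omega>. \<lambda>t\<in>I. Y (t + h) \<omega>) = distr M ?P (\<lambda>\<omega>. \<lambda>t\<in>I. Y t \<omega>)"
    using Y[unfolded stationary_field_def, THEN conjunct2, rule_format, of I h] I by simp
  moreover have "\<forall>t\<in>I. t + 0 \<in> T" using I by auto
  ultimately show "distr M ?P (\<lambda>\<omega>. \<lambda>t\<in>I. G (Y (t + h) \<omega>)) = distr M ?P (\<lambda>\<omega>. \<lambda>t\<in>I. G (Y t \<omega>))"
    using map[OF I(3)] map[of 0] by simp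
qed

text \<open>Since \<open>\<bar>C\<bar> < 1\<close>, all integrals in the series are dominated by that of \<open>\<bar>C\<bar>\<close>, and the
Hermite coefficients, divided by the factorials, are summable.\<close>

lemma integral_series_finite_if_integrable:
  fixes C :: "'i \<Rightarrow> real"
  assumes C: "integrable N C" and C1: "AE t in N. \<bar>C t\<bar> < 1" and \<mu>: "finite_measure \<mu>"
  shows "integral_series_finite N (\<lambda>k. hermite_coeff G \<mu> (k - 1) / fact k) (\<lambda>k t. \<bar>C t\<bar> * C t ^ (k - 1))"
proof -
  have [measurable]: "C \<in> borel_measurable N" using C by simp
  have le: "AE t in N. norm (\<bar>C t\<bar> * C t ^ k) \<le> norm (C t)" for k
    using C1 by eventually_elim (auto simp: abs_mult power_abs power_le_one mult_left_le)
  have int: "integrable N (\<lambda>t. \<bar>C t\<bar> * C t ^ k)" for k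
    by (rule Bochner_Integration.integrable_bound[OF C _ le]) simp
  let ?K = "(measure \<mu> (space \<mu>))\<^sup>2 * (\<integral>t. \<bar>C t\<bar> \<partial>N)"
  have "summable (\<lambda>k. hermite_coeff G \<mu> k / fact (Suc k) * (\<integral>t. \<bar>C t\<bar> * C t ^ k \<partial>N))"
  proof (rule summable_comparison_test')
    show "summable (\<lambda>k. gauss_deriv_bound k / fact (Suc k) * ?K)"
      by (intro summable_mult2 summable_gauss_deriv_bound)
    fix k :: nat
    have "\<bar>\<integral>t. \<bar>C t\<bar> * C t ^ k \<partial>N\<bar> \<le> (\<integral>t. \<bar>\<bar>C t\<bar> * C t ^ k\<bar> \<partial>N)"
      by (rule integral_abs_bound)
    also have "\<dots> \<le> (\<integral>t. \<bar>C t\<bar> \<partial>N)"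
      using le[of k] by (intro integral_mono_AE integrable_abs int C) simp
    finally have "\<bar>\<integral>t. \<bar>C t\<bar> * C t ^ k \<partial>N\<bar> \<le> (\<integral>t. \<bar>C t\<bar> \<partial>N)" .
    moreover have "0 \<le> hermite_coeff G \<mu> k" by (simp add: hermite_coeff_def)
    ultimately have "norm (hermite_coeff G \<mu> k / fact (Suc k) * (\<integral>t. \<bar>C t\<bar> * C t ^ k \<partial>N))
        \<le> (gauss_deriv_bound k * (measure \<mu> (space \<mu>))\<^sup>2) / fact (Suc k) * (\<integral>t. \<bar>C t\<bar> \<partial>N)"
      unfolding real_norm_def abs_mult
      using hermite_coeff_le[OF \<mu>, of G k]
      by (intro mult_mono) (auto simp: divide_right_mono intro!: divide_nonneg_nonneg mult_nonneg_nonneg gauss_deriv_bound_nonneg simp del: fact_Suc)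
    then show "norm (hermite_coeff G \<mu> k / fact (Suc k) * (\<integral>t. \<bar>C t\<bar> * C t ^ k \<partial>N))
        \<le> gauss_deriv_bound k / fact (Suc k) * ?K"
      by (simp add: mult_ac)
  qed
  with int show ?thesis by (simp add: integral_series_finite_def)
qed

theorem theorem3p6:
  fixes M :: "'w measure"
    and T :: "(real ^ 'd) set"
    and Y :: "real ^ 'd \<Rightarrow> 'w \<Rightarrow> real"
    and C :: "real ^ 'd \<Rightarrow> real"
    and G :: "real \<Rightarrow> real"
  assumes "prob_space M"
    and "\<not> bounded T" and "0 \<in> T" and "T \<in> sets lebesgue"
    and "stationary_field M T Y" and "gaussian_field M T Y"
    and "\<And>t. t \<in> T \<Longrightarrow> prob_space.expectation M (Y t) = 0"
    and "\<And>t. t \<in> T \<Longrightarrow> prob_space.variance M (Y t) = 1"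
    and C_def: "\<And>t. t \<in> T \<Longrightarrow> C t = covariance M (Y 0) (Y t)"
    and "C \<in> borel_measurable (index_measure T)"
    and "countable T \<Longrightarrow> \<forall>t\<in>T - {0}. \<bar>C t\<bar> < 1"
    and "uncountable T \<Longrightarrow> AE t in lebesgue_on T. \<bar>C t\<bar> < 1"
    and "strict_mono G \<or> (\<forall>x y. x < y \<longrightarrow> G y < G x)"
    and "\<And>x. continuous (at_right x) G"
  shows "short_range_dependent M T (\<lambda>t \<omega>. G (Y t \<omega>)) \<longleftrightarrow>
    (\<forall>\<mu>. finite_real_measure \<mu> \<longrightarrow>
       integral_series_finite (index_measure T)
         (\<lambda>k. hermite_coeff G \<mu> (k - 1) / fact k)
         (\<lambda>k t. \<bar>C t\<bar> * C t ^ (k - 1)))"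
proof -
  interpret prob_space M by fact
  note mean = assms(7) and var = assms(8) and G = assms(13)
  let ?N = "index_measure T" and ?X = "\<lambda>t \<omega>. G (Y t \<omega>)"
  let ?\<delta> = "return borel (G 0)"
  have C_meas[measurable]: "C \<in> borel_measurable ?N" by fact
  have C_less_1: "AE t in ?N. \<bar>C t\<bar> < 1"
    unfolding index_measure_def using assms(11,12)
    by (cases "countable T") (simp_all add: AE_count_space)
  have pair: "std_gaussian_pair M (Y 0) (Y t) (C t)" if t: "t \<in> T" and Ct: "\<bar>C t\<bar> < 1" for t
  proof
    have sq: "expectation (\<lambda>x. (Y k x)\<^sup>2) = 1" if "k \<in> T" for k
      using var[OF that] mean[OF that] by simp
    then show "expectation (\<lambda>x. (Y 0 x)\<^sup>2) = 1" "expectation (\<lambda>x. (Y t x)\<^sup>2) = 1"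
      using \<open>0 \<in> T\<close> t by auto
    then show "integrable M (\<lambda>x. (Y 0 x)\<^sup>2)" "integrable M (\<lambda>x. (Y t x)\<^sup>2)"
      by (auto intro: ccontr simp: not_integrable_integral_eq)
    show corr: "expectation (\<lambda>x. Y 0 x * Y t x) = C t"
      using C_def[OF t] mean[OF t] mean[OF \<open>0 \<in> T\<close>] by (simp add: covariance_def)
    \<comment> \<open>\<open>C 0\<close> is the variance \<open>1\<close>. In the sum over \<open>{0, t}\<close> below the two indices are therefore
      distinct.\<close>
    have "t \<noteq> 0"
      using corr sq[OF \<open>0 \<in> T\<close>] Ct by (auto simp: power2_eq_square)
    show "gaussian_rv M (\<lambda>x. a * Y 0 x + b * Y t x)" for a b
    proof -
      have "\<forall>I c. finite I \<longrightarrow> I \<subseteq> T \<longrightarrow> gaussian_rv M (\<lambda>x. \<Sum>k\<in>I. c k * Y k x)"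
        using \<open>gaussian_field M T Y\<close> by (simp add: gaussian_field_def)
      from this[rule_format, of "{0, t}" "\<lambda>k. if k = 0 then a else b"]
      show ?thesis using \<open>t \<noteq> 0\<close> \<open>0 \<in> T\<close> t by simp
    qed
  qed (use mean t \<open>0 \<in> T\<close> Ct in auto)
  have N_T: "AE t in ?N. t \<in> T"
    unfolding index_measure_def by (rule AE_I2) (auto split: if_splits)
  have cov_le: "AE t in ?N. \<forall>u v. \<bar>exceedance_cov M ?X t u v\<bar> \<le> 4 * \<bar>C t\<bar>"
    using N_T C_less_1
    by eventually_elim
       (auto simp: exceedance_cov_def intro!: std_gaussian_pair.abs_covariance_exceedance_le[OF pair G])
  have cov_ge: "AE t in ?N. std_normal_density 1 * std_normal_density 2 * \<bar>C t\<bar>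
      \<le> \<bar>exceedance_cov M ?X t (G 0) (G 0)\<bar>"
    using N_T C_less_1
    by eventually_elim
       (auto simp: exceedance_cov_def intro!: std_gaussian_pair.abs_covariance_exceedance_ge[OF pair G])
  have \<delta>: "finite_real_measure ?\<delta>"
    using prob_space_return[of "G 0" borel] by (simp add: finite_real_measure_def prob_space.finite_measure)

  have integrable_if_srd: "integrable ?N C" if srd: "short_range_dependent M T ?X"
  proof -
    let ?c = "std_normal_density 1 * std_normal_density 2"
    have c: "?c > 0" using normal_density_pos[of 1 0] by simp
    \<comment> \<open>The inner integrand is not known to be measurable, so it is bounded below by its value on a
      single point of full mass.\<close>
    have point: "ennreal \<bar>exceedance_cov M ?X t (G 0) (G 0)\<bar>
        \<le> (\<integral>\<^sup>+p. ennreal \<bar>exceedance_cov M ?X t (fst p) (snd p)\<bar> \<partial>(?\<delta> \<Otimes>\<^sub>M ?\<delta>))" for t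
    proof -
      interpret R: prob_space ?\<delta> by (rule prob_space_return) simp
      have S: "{G 0} \<times> {G 0} \<in> sets (?\<delta> \<Otimes>\<^sub>M ?\<delta>)"
        by (rule pair_measureI) simp_all
      have "emeasure (?\<delta> \<Otimes>\<^sub>M ?\<delta>) ({G 0} \<times> {G 0}) = 1"
        by (subst R.emeasure_pair_measure_Times) auto
      then have "ennreal \<bar>exceedance_cov M ?X t (G 0) (G 0)\<bar>
          = (\<integral>\<^sup>+p. ennreal \<bar>exceedance_cov M ?X t (G 0) (G 0)\<bar> * indicator ({G 0} \<times> {G 0}) p \<partial>(?\<delta> \<Otimes>\<^sub>M ?\<delta>))"
        by (simp only: nn_integral_cmult_indicator[OF S] mult_1_right)
      also have "\<dots> \<le> (\<integral>\<^sup>+p. ennreal \<bar>exceedance_cov M ?X t (fst p) (snd p)\<bar> \<partial>(?\<delta> \<Otimes>\<^sub>M ?\<delta>))"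
      proof (rule nn_integral_mono)
        show "ennreal \<bar>exceedance_cov M ?X t (G 0) (G 0)\<bar> * indicator ({G 0} \<times> {G 0}) p
            \<le> ennreal \<bar>exceedance_cov M ?X t (fst p) (snd p)\<bar>" for p
          by (cases "p = (G 0, G 0)") (simp_all add: indicator_def)
      qed
      finally show ?thesis .
    qed
    have "ennreal ?c * (\<integral>\<^sup>+t. ennreal (norm (C t)) \<partial>?N) = (\<integral>\<^sup>+t. ennreal (?c * \<bar>C t\<bar>) \<partial>?N)"
      using c by (subst nn_integral_cmult[symmetric]) (auto simp: ennreal_mult)
    also have "\<dots> \<le> srd_variance M T ?X ?\<delta>"
      unfolding srd_variance_def
      using cov_ge by (intro nn_integral_mono_AE) (auto elim!: eventually_mono intro: order_trans[OF _ point] ennreal_leI)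
    also have "\<dots> < \<infinity>" using srd \<delta> by (simp add: short_range_dependent_def)
    finally have "(\<integral>\<^sup>+t. ennreal (norm (C t)) \<partial>?N) < \<infinity>"
      using c by (auto simp: ennreal_mult_less_top)
    then show ?thesis by (simp add: integrable_iff_bounded)
  qed
  have srd_if_integrable: "short_range_dependent M T ?X" if C: "integrable ?N C"
    unfolding short_range_dependent_def
  proof (intro conjI allI impI)
    show "stationary_field M T ?X"
      using assms(5) borel_measurable_strictly_monotone[OF G] by (rule stationary_field_compose)
    fix \<mu> :: "real measure" assume "finite_real_measure \<mu>"
    then interpret finite_measure \<mu> by (simp add: finite_real_measure_def)
    interpret P: finite_measure "\<mu> \<Otimes>\<^sub>M \<mu>"
      by (rule finite_measure_pair_measure) unfold_locales
    let ?m = "emeasure (\<mu> \<Otimes>\<^sub>M \<mu>) (space (\<mu> \<Otimes>\<^sub>M \<mu>))"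
    have "srd_variance M T ?X \<mu> \<le> (\<integral>\<^sup>+t. (4 * ?m) * ennreal (norm (C t)) \<partial>?N)"
      unfolding srd_variance_def
    proof (rule nn_integral_mono_AE)
      show "AE t in ?N. (\<integral>\<^sup>+p. ennreal \<bar>exceedance_cov M ?X t (fst p) (snd p)\<bar> \<partial>(\<mu> \<Otimes>\<^sub>M \<mu>))
          \<le> (4 * ?m) * ennreal (norm (C t))"
        using cov_le
      proof eventually_elim
        case (elim t)
        then have "(\<integral>\<^sup>+p. ennreal \<bar>exceedance_cov M ?X t (fst p) (snd p)\<bar> \<partial>(\<mu> \<Otimes>\<^sub>M \<mu>))
            \<le> (\<integral>\<^sup>+p. ennreal (4 * \<bar>C t\<bar>) \<partial>(\<mu> \<Otimes>\<^sub>M \<mu>))"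
          by (intro nn_integral_mono ennreal_leI) auto
        also have "\<dots> = (4 * ?m) * ennreal (norm (C t))"
          by (simp add: ennreal_mult mult_ac)
        finally show ?case .
      qed
    qed
    also have "\<dots> = (4 * ?m) * (\<integral>\<^sup>+t. ennreal (norm (C t)) \<partial>?N)"
      by (rule nn_integral_cmult) simp
    also have "\<dots> < \<infinity>"
      using C P.emeasure_finite[of "space (\<mu> \<Otimes>\<^sub>M \<mu>)"]
      by (auto simp: integrable_iff_bounded ennreal_mult_eq_top_iff less_top[symmetric])
    finally show "srd_variance M T ?X \<mu> < \<infinity>" .
  qed
  have integrable_if_series: "integrable ?N C"
    if "integral_series_finite ?N (\<lambda>k. hermite_coeff G ?\<delta> (k - 1) / fact k)
         (\<lambda>k t. \<bar>C t\<bar> * C t ^ (k - 1))"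
  proof -
    have "hermite_coeff G ?\<delta> (1 - 1) / fact 1 \<noteq> 0 \<longrightarrow> integrable ?N (\<lambda>t. \<bar>C t\<bar> * C t ^ (1 - 1))"
      using that order_refl unfolding integral_series_finite_def by blast
    then have "integrable ?N (\<lambda>t. \<bar>C t\<bar>)"
      using hermite_coeff_return_0_pos[OF G, of 0] by simp
    then show ?thesis by (subst (asm) integrable_abs_iff) (rule C_meas)
  qed
  show ?thesis
  proof (intro iffI allI impI)
    fix \<mu> assume srd: "short_range_dependent M T ?X" and \<mu>: "finite_real_measure \<mu>"
    show "integral_series_finite ?N (\<lambda>k. hermite_coeff G \<mu> (k - 1) / fact k)
        (\<lambda>k t. \<bar>C t\<bar> * C t ^ (k - 1))"
      using integrable_if_srd[OF srd] C_less_1 \<mu>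
      by (intro integral_series_finite_if_integrable) (auto simp: finite_real_measure_def)
  next
    assume series: "\<forall>\<mu>. finite_real_measure \<mu> \<longrightarrow> integral_series_finite ?N
        (\<lambda>k. hermite_coeff G \<mu> (k - 1) / fact k) (\<lambda>k t. \<bar>C t\<bar> * C t ^ (k - 1))"
    show "short_range_dependent M T ?X"
      by (rule srd_if_integrable, rule integrable_if_series, rule series[rule_format, OF \<delta>])
  qed
qed

end
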